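(* Let $K$ be a finite set and let $k(x,y)\ge 0$ ($x\ne y\in K$) be the transition rates of an irreducible Markov jump process $X_t$ on $K$. For $x,z\in K$ let $\tau(x,z)$ be the mean first-passage time to reach $z$ when started from $x$, i.e. the solution, for each fixed $z$, of $$\sum_y k(x,y)[\tau(y,z)-\tau(x,z)]+1=0\quad (x\ne z),\qquad \tau(z,z)=0 .$$ Then $$\tau(x,z)=\frac{w(x,z)}{w(z)}\quad\text{for } x\ne z,\qquad \tau(x,x)=0,$$ where $w(z)$ is the total weight of spanning trees rooted at $z$ and $w(x,z)$ is the total weight of rooted spanning two-tree forests in which $x$ and $z$ lie in different trees and $z$ is a root.
   Context: The associated digraph $G$ has vertex set $K$ and an arc $(x,y)$, $x\neq y$, whenever $k(x,y)>0$; irreducibility means that $G$ is strongly connected. The mean first-passage time is $\tau(x,z)=\langle \inf\{t\ge 0: X_t=z\}\mid X_0=x\rangle$. A rooted tree is a tree formed by arcs of $G$, all oriented toward a distinguished vertex, its root (every non-root vertex has exactly one outgoing arc in the tree, the root has none); a single vertex counts as a tree. The weight of a collection of arcs (tree or forest) is the product of $k(u,u')$ over its arcs $(u,u')$ (empty product $=1$), and the weight of a set of trees or forests is the sum of the weights of its elements. $\mathcal{T}_z$ is the set of all spanning trees rooted at $z$ and $w(z)=\sum_{T\in\mathcal{T}_z}\prod_{(u,u')\in T}k(u,u')$. $\mathcal{F}^{x,z}$ is the set of all rooted spanning forests consisting of exactly two (vertex-disjoint) rooted trees such that $x$ and $z$ are in different trees, the tree containing $z$ is rooted at $z$, and the other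 tree (containing $x$) is rooted at any of its vertices (different choices of root give different forests). $w(x,z)=\sum_{F\in\mathcal{F}^{x,z}}\prod_{(u,u')\in F}k(u,u')$. *)

theory Defs
  imports "HOL-Probability.Probability" "Graph_Theory.Digraph_Component"
begin

section \<open>The digraph of a system of rates, rooted trees and two-tree forests\<close>

definition rate_digraph :: "'a set \<Rightarrow> ('a \<Rightarrow> 'a \<Rightarrow> real) \<Rightarrow> ('a, 'a \<times> 'a) pre_digraph" where
  "rate_digraph K k =
     \<lparr> verts = K, arcs = {(x, y). x \<in> K \<and> y \<in> K \<and> x \<noteq> y \<and> 0 < k x y}, tail = fst, head = snd \<rparr>"

definition irreducible_rates :: "'a set \<Rightarrow> ('a \<Rightarrow> 'a \<Rightarrow> real) \<Rightarrow> bool" where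
  "irreducible_rates K k \<longleftrightarrow> strongly_connected (rate_digraph K k)"

text \<open>
  The library notion \<open>tree\<close> asks for connectedness of the underlying symmetric graph and for the
  absence of \<^emph>\<open>directed\<close> cycles. Together with the condition on the out-degrees (which forces
  one arc less than there are vertices) this also excludes undirected cycles.
\<close>

definition rooted_tree :: "('a, 'b) pre_digraph \<Rightarrow> 'a \<Rightarrow> ('a, 'b) pre_digraph \<Rightarrow> bool" where
  "rooted_tree G r T \<longleftrightarrow>
     subgraph T G \<and> tree T \<and> r \<in> verts T \<and> out_degree T r = 0 \<and>
     (\<forall>v \<in> verts T - {r}. out_degree T v = 1)"

definition spanning_rooted_trees :: "('a, 'b) pre_digraph \<Rightarrow> 'a \<Rightarrow> ('a, 'b) pre_digraph set" where
  "spanning_rooted_trees G z = {T. rooted_tree G z T \<and> spanning T G}"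

text \<open>
  A forest is given as the pair (tree containing \<open>x\<close>, tree rooted at \<open>z\<close>). The root of the first
  tree is its only vertex without outgoing arc, so that different roots give different pairs.
\<close>

definition two_tree_forests ::
  "('a, 'b) pre_digraph \<Rightarrow> 'a \<Rightarrow> 'a \<Rightarrow> (('a, 'b) pre_digraph \<times> ('a, 'b) pre_digraph) set" where
  "two_tree_forests G x z =
     {(S, T). (\<exists>r. rooted_tree G r S) \<and> rooted_tree G z T \<and> x \<in> verts S \<and>
        verts S \<inter> verts T = {} \<and> verts S \<union> verts T = verts G}"

definition arcs_weight :: "('a \<Rightarrow> 'a \<Rightarrow> real) \<Rightarrow> ('a \<times> 'a) set \<Rightarrow> real" where
  "arcs_weight k A = (\<Prod>(u, u') \<in> A. k u u')"

definition tree_weight :: "'a set \<Rightarrow> ('a \<Rightarrow> 'a \<Rightarrow> real) \<Rightarrow> 'a \<Rightarrow> real" where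
  "tree_weight K k z =
     (\<Sum>T \<in> spanning_rooted_trees (rate_digraph K k) z. arcs_weight k (arcs T))"

definition forest_weight :: "'a set \<Rightarrow> ('a \<Rightarrow> 'a \<Rightarrow> real) \<Rightarrow> 'a \<Rightarrow> 'a \<Rightarrow> real" where
  "forest_weight K k x z =
     (\<Sum>(S, T) \<in> two_tree_forests (rate_digraph K k) x z. arcs_weight k (arcs S \<union> arcs T))"

section \<open>Markov jump processes with given rates\<close>

text \<open>The diagonal values of \<open>k\<close> play no role, here and elsewhere.\<close>

definition generator :: "'a set \<Rightarrow> ('a \<Rightarrow> 'a \<Rightarrow> real) \<Rightarrow> 'a \<Rightarrow> 'a \<Rightarrow> real" where
  "generator K k x y = (if x = y then - (\<Sum>u \<in> K - {x}. k x u) else k x y)"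

definition transition_function ::
  "'a set \<Rightarrow> ('a \<Rightarrow> 'a \<Rightarrow> real) \<Rightarrow> (real \<Rightarrow> 'a \<Rightarrow> 'a \<Rightarrow> real) \<Rightarrow> bool" where
  "transition_function K k P \<longleftrightarrow>
     (\<forall>t\<ge>0. \<forall>x\<in>K. (\<forall>y\<in>K. 0 \<le> P t x y) \<and> (\<Sum>y\<in>K. P t x y) = 1) \<and>
     (\<forall>x\<in>K. \<forall>y\<in>K. P 0 x y = (if x = y then 1 else 0)) \<and>
     (\<forall>s\<ge>0. \<forall>t\<ge>0. \<forall>x\<in>K. \<forall>y\<in>K. P (s + t) x y = (\<Sum>u\<in>K. P s x u * P t u y)) \<and>
     (\<forall>x\<in>K. \<forall>y\<in>K. ((\<lambda>t. P t x y) has_real_derivative generator K k x y) (at 0 within {0..}))"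

text \<open>
  The initial distribution is arbitrary. Paths are right-continuous for the discrete topology
  of \<open>K\<close>. The last condition is the Markov property, written without division.
\<close>

definition markov_jump_process ::
  "'a set \<Rightarrow> ('a \<Rightarrow> 'a \<Rightarrow> real) \<Rightarrow> 'w measure \<Rightarrow> (real \<Rightarrow> 'w \<Rightarrow> 'a) \<Rightarrow> bool" where
  "markov_jump_process K k M X \<longleftrightarrow>
     prob_space M \<and>
     (\<forall>t\<ge>0. X t \<in> measurable M (count_space K)) \<and>
     (\<forall>\<omega>\<in>space M. \<forall>t\<ge>0. eventually (\<lambda>s. X s \<omega> = X t \<omega>) (at_right t)) \<and>
     (\<exists>P. transition_function K k P \<and>
       (\<forall>(n::nat) (t :: nat \<Rightarrow> real) (x :: nat \<Rightarrow> 'a).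
          0 \<le> t 0 \<longrightarrow> (\<forall>i\<le>n. t i \<le> t (Suc i)) \<longrightarrow> (\<forall>i\<le>Suc n. x i \<in> K) \<longrightarrow>
          measure M {\<omega>\<in>space M. \<forall>i\<le>Suc n. X (t i) \<omega> = x i} =
          measure M {\<omega>\<in>space M. \<forall>i\<le>n. X (t i) \<omega> = x i} * P (t (Suc n) - t n) (x n) (x (Suc n))))"

section \<open>Mean first-passage times\<close>

text \<open>The infimum is \<open>\<infinity>\<close> on paths that never visit \<open>z\<close>.\<close>

definition first_passage_time :: "(real \<Rightarrow> 'w \<Rightarrow> 'a) \<Rightarrow> 'a \<Rightarrow> 'w \<Rightarrow> ennreal" where
  "first_passage_time X z \<omega> = Inf {ennreal t | t. 0 \<le> t \<and> X t \<omega> = z}"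

definition mean_first_passage_time ::
  "'w measure \<Rightarrow> (real \<Rightarrow> 'w \<Rightarrow> 'a) \<Rightarrow> 'a \<Rightarrow> 'a \<Rightarrow> ennreal" where
  "mean_first_passage_time M X x z =
     (\<integral>\<^sup>+ \<omega>. first_passage_time X z \<omega> \<partial>uniform_measure M {\<omega>\<in>space M. X 0 \<omega> = x})"

definition first_passage_equations ::
  "'a set \<Rightarrow> ('a \<Rightarrow> 'a \<Rightarrow> real) \<Rightarrow> ('a \<Rightarrow> 'a \<Rightarrow> real) \<Rightarrow> bool" where
  "first_passage_equations K k \<tau> \<longleftrightarrow>
     (\<forall>z\<in>K. \<tau> z z = 0 \<and>
        (\<forall>x\<in>K. x \<noteq> z \<longrightarrow> (\<Sum>y\<in>K. k x y * (\<tau> y z - \<tau> x z)) + 1 = 0))"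

end

theory Submission
  imports Defs
begin

text \<open>
  A rooted forest on \<open>K\<close> is the same thing as a map \<open>f : K \<rightarrow> K\<close> that sends every vertex along its
  outgoing arc and fixes the roots; the forest condition says that every orbit ends in a fixed point.
  If the weight of a fixed point is taken to be \<open>1\<close>, the weight of the forest is the product of
  the weights of the steps \<open>v \<mapsto> f v\<close>. In this encoding the first-passage equation for \<open>w(x,z)\<close> is
  one bijection, \<open>(f, y) \<mapsto> (f(x := y), f x)\<close>: redirect \<open>x\<close> to \<open>y\<close> and remember its old target.
  It is its own inverse and preserves \<open>k(x,y)\<close> times the weight of \<open>f\<close>. It takes
  the pairs with \<open>x\<close> outside and \<open>y\<close> inside the tree of \<open>z\<close> to the pairs with \<open>x\<close> inside and
  \<open>y\<close> outside that tree, except when \<open>x\<close> was a root of \<open>f\<close>; then the image is a spanning tree rooted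
  at \<open>z\<close>, and these account for the term \<open>w(z)\<close> (\<open>sum_swap\<close>, \<open>forest_maps_equation\<close>).
  Irreducibility makes \<open>w(z)\<close> positive (\<open>tree_weight_pos\<close>), and it makes the solution unique by the
  maximum principle (\<open>subharmonic_le_boundary\<close>).

  For the probabilistic part, let \<open>h\<close> be the nonnegative solution for the target \<open>z\<close>. The process
  observed at the times \<open>0, \<delta>, 2\<delta>, \<dots>\<close> is a Markov chain with transition matrix
  \<open>P \<delta>\<close>, and \<open>P \<delta> h = h - \<delta> + o(\<delta>)\<close> off \<open>z\<close>, because \<open>h\<close> solves the equation for the generator. Summing
  this drift along the chain killed at \<open>z\<close> shows that the mean hitting time on the grid is
  \<open>h\<close> up to a factor \<open>1 + o(1)\<close> (\<open>killed_chain_occupation\<close>, \<open>grid_time_mean\<close>). Along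
  \<open>\<delta> = 2\<^sup>-\<^sup>n\<close> the hitting times on the grid decrease, and by right-continuity of the paths they tend to
  the first passage time, so monotone convergence gives the mean \<open>h\<close>.
\<close>

section \<open>Orbits of self-maps\<close>

text \<open>
  If \<open>f\<close> sends each vertex of a rooted forest along its outgoing arc and \<open>w\<close> is a root, this is the
  vertex set of the tree of \<open>w\<close>.
\<close>
inductive_set basin :: "('a \<Rightarrow> 'a) \<Rightarrow> 'a \<Rightarrow> 'a set" for f w where
  base: "w \<in> basin f w"
| step: "f v \<in> basin f w \<Longrightarrow> v \<in> basin f w"

lemma basin_image: "f w = w \<Longrightarrow> v \<in> basin f w \<Longrightarrow> f v \<in> basin f w"
  by (metis basin.simps)

lemma basin_trans: "u \<in> basin f v \<Longrightarrow> v \<in> basin f w \<Longrightarrow> u \<in> basin f w"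
  by (induction rule: basin.induct) (auto intro: basin.step)

lemma basin_fixed_point: "v \<in> basin f w \<Longrightarrow> f v = v \<Longrightarrow> v = w"
  by (induction rule: basin.induct) auto

lemma basin_unique:
  assumes "v \<in> basin f a" "v \<in> basin f b" "f a = a" "f b = b"
  shows "a = b"
  using assms
proof (induction rule: basin.induct)
  case base
  then show ?case by (blast intro: basin_fixed_point)
next
  case (step v)
  then show ?case by (blast intro: basin_image)
qed

text \<open>
  An orbit that ends in a fixed point contains no cycle except the fixed point itself.
\<close>
lemma basin_acyclic:
  assumes "x \<in> basin f w" "f w = w" "f x \<in> basin f x"
  shows "x = w"
  using assms
proof (induction rule: basin.induct)
  case (step v)
  have "f (f v) \<in> basin f (f v)"
  proof (cases "f v = v")
    case False
    from \<open>f v \<in> basin f v\<close> False have "f (f v) \<in> basin f v"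
      by (metis basin.cases)
    moreover have "v \<in> basin f (f v)"
      by (rule basin.step, rule basin.base)
    ultimately show ?thesis by (rule basin_trans)
  qed (simp add: basin.base)
  from step.IH[OF \<open>f w = w\<close> this] have "f v = w" .
  with \<open>f v \<in> basin f v\<close> \<open>f w = w\<close> have "w \<in> basin f v" by simp
  from basin_fixed_point[OF this \<open>f w = w\<close>] show ?case by (rule sym)
qed (rule refl)

text \<open>
  Until it first meets \<open>x\<close>, an orbit does not notice that \<open>f\<close> was changed at \<open>x\<close>.
\<close>
lemma basin_fun_upd:
  "v \<in> basin f w \<Longrightarrow> v \<in> basin (f(x := y)) w \<or> v \<in> basin (f(x := y)) x"
proof (induction rule: basin.induct)
  case (step v)
  then show ?case by (cases "v = x") (auto intro: basin.intros)
qed (auto intro: basin.base)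

lemma basin_fun_upd_avoiding:
  "v \<in> basin f w \<Longrightarrow> v \<notin> basin f x \<Longrightarrow> v \<in> basin (f(x := y)) w"
proof (induction rule: basin.induct)
  case (step v)
  then have "v \<noteq> x" "f v \<notin> basin f x" by (auto intro: basin.intros)
  with step show ?case by (auto intro: basin.step)
qed (auto intro: basin.base)

text \<open>
  Used to glue two trees on disjoint vertex sets: each set is invariant under the combined map.
\<close>
lemma basin_cong:
  assumes "v \<in> basin f w" "v \<in> V" "f ` V \<subseteq> V" "\<And>u. u \<in> V \<Longrightarrow> g u = f u"
  shows "v \<in> basin g w"
  using assms(1,2)
proof (induction rule: basin.induct)
  case (step v)
  then have "g v \<in> basin g w" using assms(3,4) by auto
  then show ?case by (rule basin.step)
qed (auto intro: basin.base)

section \<open>Trees and forests as maps, and the exchange of arcs\<close>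

text \<open>
  The map encodings of spanning trees and of two-tree forests. Arcs of rate zero are admitted here;
  such maps have weight zero, and their presence leaves the target of a redirected vertex
  unrestricted.
\<close>
definition tree_maps :: "'a set \<Rightarrow> 'a \<Rightarrow> ('a \<Rightarrow> 'a) set" where
  "tree_maps K z = {f \<in> K \<rightarrow>\<^sub>E K. f z = z \<and> K \<subseteq> basin f z}"

definition forest_maps :: "'a set \<Rightarrow> 'a \<Rightarrow> 'a \<Rightarrow> ('a \<Rightarrow> 'a) set" where
  "forest_maps K x z = {f \<in> K \<rightarrow>\<^sub>E K. f z = z \<and>
     (\<exists>r\<in>K. f r = r \<and> r \<noteq> z \<and> x \<in> basin f r \<and> K \<subseteq> basin f z \<union> basin f r)}"

text \<open>
  A root is a fixed point, hence the value \<open>1\<close> on the diagonal: a missing arc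
  contributes the empty product.
\<close>
definition step_weight :: "('a \<Rightarrow> 'a \<Rightarrow> real) \<Rightarrow> 'a \<Rightarrow> 'a \<Rightarrow> real" where
  "step_weight k u v = (if u = v then 1 else k u v)"

definition map_weight :: "'a set \<Rightarrow> ('a \<Rightarrow> 'a \<Rightarrow> real) \<Rightarrow> ('a \<Rightarrow> 'a) \<Rightarrow> real" where
  "map_weight K k f = (\<Prod>v\<in>K. step_weight k v (f v))"

lemma fun_upd_in_PiE: "f \<in> K \<rightarrow>\<^sub>E K \<Longrightarrow> x \<in> K \<Longrightarrow> y \<in> K \<Longrightarrow> f(x := y) \<in> K \<rightarrow>\<^sub>E K"
  using PiE_fun_upd[of y "\<lambda>_. K" x f K] by (simp add: insert_absorb)

text \<open>
  Redirecting \<open>x\<close> exchanges the factor of its old step for that of its new step.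
\<close>
lemma map_weight_swap:
  assumes "finite K" "x \<in> K"
  shows "step_weight k x (f x) * map_weight K k (f(x := y)) = step_weight k x y * map_weight K k f"
proof -
  have "map_weight K k (f(x := y)) = step_weight k x y * (\<Prod>v\<in>K - {x}. step_weight k v (f v))"
    unfolding map_weight_def using assms by (simp add: prod.remove[of K x])
  moreover have "map_weight K k f = step_weight k x (f x) * (\<Prod>v\<in>K - {x}. step_weight k v (f v))"
    unfolding map_weight_def using assms by (simp add: prod.remove[of K x])
  ultimately show ?thesis by simp
qed

lemma tree_mapsI: "f \<in> K \<rightarrow>\<^sub>E K \<Longrightarrow> f z = z \<Longrightarrow> K \<subseteq> basin f z \<Longrightarrow> f \<in> tree_maps K z"
  by (simp add: tree_maps_def)

lemma forest_mapsI:
  assumes "f \<in> K \<rightarrow>\<^sub>E K" "f z = z" "r \<in> K" "f r = r" "r \<noteq> z" "x \<in> basin f r"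
    "K \<subseteq> basin f z \<union> basin f r"
  shows "f \<in> forest_maps K x z"
  using assms unfolding forest_maps_def by blast

lemma forest_mapsE:
  assumes "f \<in> forest_maps K x z"
  obtains r where "f \<in> K \<rightarrow>\<^sub>E K" "f z = z" "r \<in> K" "f r = r" "r \<noteq> z" "x \<in> basin f r"
    "K \<subseteq> basin f z \<union> basin f r"
  using assms unfolding forest_maps_def by blast

lemma finite_maps:
  assumes "finite K"
  shows "finite (tree_maps K z)" "finite (forest_maps K x z)"
  by (rule finite_subset[of _ "K \<rightarrow>\<^sub>E K"], auto simp: tree_maps_def forest_maps_def finite_PiE assms)+

lemma forest_map_not_in_basin:
  assumes "f \<in> forest_maps K x z"
  shows "x \<notin> basin f z"
proof -
  from assms obtain r where "x \<in> basin f r" "f r = r" "f z = z" "r \<noteq> z"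
    by (elim forest_mapsE)
  then show ?thesis using basin_unique[of x f r z] by blast
qed

lemma forest_maps_same: "forest_maps K z z = {}"
proof (intro equals0I)
  fix f assume "f \<in> forest_maps K z z"
  from forest_map_not_in_basin[OF this] show False by (simp add: basin.base)
qed

lemma forest_map_other_tree:
  assumes "y \<in> K" "f \<in> forest_maps K x z" "y \<notin> basin f z"
  shows "f \<in> forest_maps K y z"
  using assms(2)
proof (rule forest_mapsE)
  fix r assume r: "f \<in> K \<rightarrow>\<^sub>E K" "f z = z" "r \<in> K" "f r = r" "r \<noteq> z" "K \<subseteq> basin f z \<union> basin f r"
  with assms have "y \<in> basin f r" by blast
  with r show ?thesis by (intro forest_mapsI[of _ _ _ r])
qed

text \<open>
  One direction of the exchange. The orbit of \<open>y\<close> avoids \<open>x\<close>, since otherwise \<open>y\<close> would reach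
  both roots; so redirecting \<open>x\<close> to \<open>y\<close> closes no cycle and carries everything above \<open>x\<close>
  over to the tree of \<open>z\<close>. The old target \<open>f x\<close> stays in the other tree because the orbit of \<open>x\<close> does not return.
\<close>
lemma swap_into_rooted:
  assumes x: "x \<in> K" "x \<noteq> z" and f: "f \<in> forest_maps K x z" and y: "y \<in> K" "y \<in> basin f z"
  shows "f(x := y) \<in> (if f x = x then tree_maps K z
                       else {g \<in> forest_maps K (f x) z. x \<in> basin g z})"
proof -
  let ?g = "f(x := y)"
  from f obtain r where r: "r \<in> K" "f r = r" "r \<noteq> z" "x \<in> basin f r" "K \<subseteq> basin f z \<union> basin f r"
    and fz: "f z = z" and fK: "f \<in> K \<rightarrow>\<^sub>E K"
    by (elim forest_mapsE)
  have gK: "?g \<in> K \<rightarrow>\<^sub>E K" using fK x y by (intro fun_upd_in_PiE)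
  have gz: "?g z = z" using fz x by simp
  have "y \<notin> basin f x"
    using basin_trans[of y f x r] basin_unique[of y f r z] r y fz by blast
  then have "y \<in> basin ?g z" using basin_fun_upd_avoiding[OF y(2)] by blast
  then have xz: "x \<in> basin ?g z" by (auto intro: basin.step)
  show ?thesis
  proof (cases "f x = x")
    case True
    then have "r = x" using basin_fixed_point[OF r(4)] by simp
    have "K \<subseteq> basin ?g z"
    proof
      fix v assume "v \<in> K"
      then have "v \<in> basin ?g z \<or> v \<in> basin ?g x"
        using r(5) \<open>r = x\<close> basin_fun_upd[of v f z x y] basin_fun_upd[of v f x x y] by auto
      then show "v \<in> basin ?g z" using xz basin_trans[of v ?g x z] by blast
    qed
    with True gK gz show ?thesis by (simp add: tree_maps_def)
  next
    case False
    then have "r \<noteq> x" using r by auto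
    have "f x \<notin> basin f x"
      using basin_acyclic[OF r(4,2)] \<open>r \<noteq> x\<close> by auto
    moreover have "f x \<in> basin f r" using basin_image[OF r(2,4)] .
    ultimately have "f x \<in> basin ?g r" using basin_fun_upd_avoiding by metis
    moreover have "K \<subseteq> basin ?g z \<union> basin ?g r"
    proof
      fix v assume "v \<in> K"
      then have "v \<in> basin ?g z \<or> v \<in> basin ?g r \<or> v \<in> basin ?g x"
        using r(5) basin_fun_upd[of v f z x y] basin_fun_upd[of v f r x y] by auto
      then show "v \<in> basin ?g z \<union> basin ?g r" using xz basin_trans[of v ?g x z] by blast
    qed
    ultimately have "?g \<in> forest_maps K (f x) z"
      using gK gz r \<open>r \<noteq> x\<close> by (intro forest_mapsI[of _ _ _ r]) simp_all
    with False xz show ?thesis by simp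
  qed
qed

text \<open>
  The converse direction; if \<open>u = x\<close>, the redirection turns \<open>x\<close> into a new root and cuts the
  spanning tree in two.
\<close>
lemma swap_from_rooted:
  assumes x: "x \<in> K" "x \<noteq> z" and u: "u \<in> K"
    and g: "g \<in> (if u = x then tree_maps K z else {g \<in> forest_maps K u z. x \<in> basin g z})"
  shows "g(x := u) \<in> forest_maps K x z" "g x \<in> K" "g x \<in> basin (g(x := u)) z"
proof -
  let ?f = "g(x := u)"
  have gK: "g \<in> K \<rightarrow>\<^sub>E K" and gz: "g z = z" and xz: "x \<in> basin g z"
    using g x by (auto simp: tree_maps_def forest_maps_def split: if_splits)
  show "g x \<in> K" using gK x by auto
  have fK: "?f \<in> K \<rightarrow>\<^sub>E K" using gK x u by (intro fun_upd_in_PiE)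
  have fz: "?f z = z" using gz x by simp
  have "g x \<notin> basin g x" using basin_acyclic[OF xz gz] x by auto
  then show "g x \<in> basin ?f z"
    using basin_fun_upd_avoiding[OF basin_image[of g, OF gz xz]] by blast
  show "?f \<in> forest_maps K x z"
  proof (cases "u = x")
    case True
    then have "K \<subseteq> basin g z" using g by (auto simp: tree_maps_def)
    then have "K \<subseteq> basin ?f z \<union> basin ?f x" using basin_fun_upd[of _ g z x u] by blast
    with fK fz x True show ?thesis by (intro forest_mapsI[of _ _ _ x]) (simp_all add: basin.base)
  next
    case False
    then have "g \<in> forest_maps K u z" using g by simp
    then obtain r where r: "r \<in> K" "g r = r" "r \<noteq> z" "u \<in> basin g r" "K \<subseteq> basin g z \<union> basin g r"
      by (elim forest_mapsE)
    have "r \<noteq> x" using basin_fixed_point[OF xz] r by auto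
    have "u \<notin> basin g x"
      using basin_trans[of u g x z] basin_unique[of u g r z] r xz gz by blast
    then have "u \<in> basin ?f r" using basin_fun_upd_avoiding[OF r(4)] by blast
    then have xr: "x \<in> basin ?f r" by (auto intro: basin.step)
    have "K \<subseteq> basin ?f z \<union> basin ?f r"
    proof
      fix v assume "v \<in> K"
      then have "v \<in> basin ?f z \<or> v \<in> basin ?f r \<or> v \<in> basin ?f x"
        using r(5) basin_fun_upd[of v g z x u] basin_fun_upd[of v g r x u] by auto
      then show "v \<in> basin ?f z \<union> basin ?f r" using xr basin_trans[of v ?f x r] by blast
    qed
    with fK fz r xr \<open>r \<noteq> x\<close> show ?thesis by (intro forest_mapsI[of _ _ _ r]) simp_all
  qed
qed

text \<open>
  The index \<open>u = x\<close> on the right collects the pairs whose forest had \<open>x\<close> as a root.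
\<close>
lemma sum_swap:
  fixes K :: "'a set"
  assumes K: "finite K" and x: "x \<in> K" "x \<noteq> z"
  shows "(\<Sum>y\<in>K. \<Sum>f | f \<in> forest_maps K x z \<and> y \<in> basin f z. step_weight k x y * map_weight K k f) =
         (\<Sum>u\<in>K. \<Sum>g\<in>(if u = x then tree_maps K z else {g \<in> forest_maps K u z. x \<in> basin g z}).
            step_weight k x u * map_weight K k g)"
    (is "(\<Sum>y\<in>K. sum _ (?A y)) = (\<Sum>u\<in>K. sum _ (?B u))")
proof -
  have fin: "finite (?A y)" "finite (?B y)" for y
    using K by (auto simp: finite_maps)
  have "(\<Sum>y\<in>K. \<Sum>f\<in>?A y. step_weight k x y * map_weight K k f) =
        (\<Sum>(y, f)\<in>Sigma K ?A. step_weight k x y * map_weight K k f)"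
    using K fin by (intro sum.Sigma) auto
  also have "\<dots> = (\<Sum>(u, g)\<in>Sigma K ?B. step_weight k x u * map_weight K k g)"
  proof (rule sum.reindex_bij_witness[where i = "\<lambda>(u, g). (g x, g(x := u))"
                                        and j = "\<lambda>(y, f). (f x, f(x := y))"], goal_cases)
    case (2 a)
    then obtain y f where a: "a = (y, f)" "y \<in> K" "f \<in> forest_maps K x z" "y \<in> basin f z" by auto
    have "f x \<in> K" using a x by (auto simp: forest_maps_def)
    with swap_into_rooted[OF x a(3,2,4)] a(1) show ?case by simp
  next
    case (4 b)
    then obtain u g where b: "b = (u, g)" "u \<in> K" "g \<in> ?B u" by auto
    from swap_from_rooted[OF x b(2,3)] b(1) show ?case by simp
  next
    case (5 a)
    then show ?case using map_weight_swap[OF K x(1)] by (auto split: prod.splits)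
  qed auto
  also have "\<dots> = (\<Sum>u\<in>K. \<Sum>g\<in>?B u. step_weight k x u * map_weight K k g)"
    using K fin by (intro sum.Sigma[symmetric]) auto
  finally show ?thesis .
qed

text \<open>
  The first-passage equation, multiplied by \<open>w(z)\<close>. In the difference of the two forest sums the
  forests with \<open>x\<close> and \<open>y\<close> in the same tree cancel; what remains is compared by \<open>sum_swap\<close>.
\<close>
theorem forest_maps_equation:
  fixes K :: "'a set" and k
  defines "F \<equiv> \<lambda>y z. \<Sum>f\<in>forest_maps K y z. map_weight K k f"
    and "T \<equiv> \<lambda>z. \<Sum>f\<in>tree_maps K z. map_weight K k f"
  assumes K: "finite K" and x: "x \<in> K" "x \<noteq> z"
  shows "(\<Sum>y\<in>K. k x y * (F y z - F x z)) + T z = 0"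
proof -
  define A where "A y = (\<Sum>f | f \<in> forest_maps K x z \<and> y \<in> basin f z. map_weight K k f)" for y
  define B where "B y = (\<Sum>f | f \<in> forest_maps K y z \<and> x \<in> basin f z. map_weight K k f)" for y
  have Ax: "A x = 0"
  proof -
    have none: "{f. f \<in> forest_maps K x z \<and> x \<in> basin f z} = {}"
      by (auto dest: forest_map_not_in_basin)
    show ?thesis unfolding A_def none by simp
  qed
  have diff: "F y z - F x z = B y - A y" if y: "y \<in> K" for y
  proof -
    have split: "F u z = (\<Sum>f | f \<in> forest_maps K u z \<and> v \<in> basin f z. map_weight K k f) +
          (\<Sum>f\<in>forest_maps K u z \<inter> forest_maps K v z. map_weight K k f)"
      if "v \<in> K" for u v
    proof -
      have "forest_maps K u z = {f. f \<in> forest_maps K u z \<and> v \<in> basin f z} \<union>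
              (forest_maps K u z \<inter> forest_maps K v z)"
        using forest_map_other_tree[OF that] by blast
      moreover have "{f. f \<in> forest_maps K u z \<and> v \<in> basin f z} \<inter>
              (forest_maps K u z \<inter> forest_maps K v z) = {}"
        by (auto dest: forest_map_not_in_basin)
      ultimately show ?thesis
        unfolding F_def using K
        by (subst sum.union_disjoint[symmetric]) (auto simp: finite_maps)
    qed
    from split[of y x] split[of x y] show ?thesis
      using x y unfolding A_def B_def by (simp add: Int_commute)
  qed
  have "(\<Sum>y\<in>K. step_weight k x y * A y) =
      (\<Sum>u\<in>K. step_weight k x u * (if u = x then T z else B u))"
  proof -
    have "(\<Sum>y\<in>K. step_weight k x y * A y) = (\<Sum>y\<in>K. \<Sum>f | f \<in> forest_maps K x z \<and> y \<in> basin f z.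
        step_weight k x y * map_weight K k f)"
      unfolding A_def by (simp only: sum_distrib_left)
    also note sum_swap[OF K x, of k]
    also have "(\<Sum>u\<in>K. \<Sum>g\<in>(if u = x then tree_maps K z else {g \<in> forest_maps K u z. x \<in> basin g z}).
            step_weight k x u * map_weight K k g) = (\<Sum>u\<in>K. step_weight k x u * (if u = x then T z else B u))"
      by (intro sum.cong) (simp_all add: A_def B_def T_def sum_distrib_left)
    finally show ?thesis .
  qed
  then have "step_weight k x x * A x + (\<Sum>y\<in>K - {x}. step_weight k x y * A y) =
      step_weight k x x * T z + (\<Sum>u\<in>K - {x}. step_weight k x u * (if u = x then T z else B u))"
    by (simp only: sum.remove[OF K x(1)] simp_thms if_True)
  moreover have "(\<Sum>u\<in>K - {x}. step_weight k x u * (if u = x then T z else B u)) = (\<Sum>u\<in>K - {x}. k x u * B u)"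
    by (intro sum.cong) (auto simp: step_weight_def)
  moreover have "(\<Sum>u\<in>K - {x}. step_weight k x u * A u) = (\<Sum>u\<in>K - {x}. k x u * A u)"
    by (intro sum.cong) (auto simp: step_weight_def)
  ultimately have "(\<Sum>y\<in>K - {x}. k x y * A y) = T z + (\<Sum>y\<in>K - {x}. k x y * B y)"
    using Ax by (simp add: step_weight_def)
  moreover have "(\<Sum>y\<in>K. k x y * (F y z - F x z)) = (\<Sum>y\<in>K - {x}. k x y * (B y - A y))"
    unfolding sum.remove[OF K x(1)] using diff by simp
  ultimately show ?thesis by (simp add: algebra_simps sum_subtractf)
qed

section \<open>Rooted subtrees of the digraph of rates\<close>

definition map_graph :: "'a set \<Rightarrow> ('a \<Rightarrow> 'a) \<Rightarrow> ('a, 'a \<times> 'a) pre_digraph" where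
  "map_graph V f = \<lparr> verts = V, arcs = (\<lambda>v. (v, f v)) ` {v \<in> V. f v \<noteq> v}, tail = fst, head = snd \<rparr>"

text \<open>
  Recovers the map from the arcs of a rooted forest; the default value \<open>v\<close> makes the roots fixed points.
\<close>
definition successor :: "('a \<times> 'a) set \<Rightarrow> 'a \<Rightarrow> 'a" where
  "successor A v = (if \<exists>u. (v, u) \<in> A then SOME u. (v, u) \<in> A else v)"

lemma map_graph_simps [simp]:
  "verts (map_graph V f) = V" "tail (map_graph V f) = fst" "head (map_graph V f) = snd"
  "arcs (map_graph V f) = {(v, f v) | v. v \<in> V \<and> f v \<noteq> v}"
  by (auto simp: map_graph_def)

lemma rate_digraph_simps [simp]:
  "verts (rate_digraph K k) = K" "tail (rate_digraph K k) = fst" "head (rate_digraph K k) = snd"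
  "arcs (rate_digraph K k) = {(x, y). x \<in> K \<and> y \<in> K \<and> x \<noteq> y \<and> 0 < k x y}"
  by (simp_all add: rate_digraph_def)

lemma wf_rate_digraph: "wf_digraph (rate_digraph K k)"
  by unfold_locales auto

lemma successor_in: "(v, u) \<in> A \<Longrightarrow> (v, successor A v) \<in> A"
  unfolding successor_def by (auto intro: someI)

lemma successor_none: "(\<And>u. (v, u) \<notin> A) \<Longrightarrow> successor A v = v"
  unfolding successor_def by auto

lemma successor_graph:
  assumes "\<And>u. (v, u) \<in> A \<longleftrightarrow> u = f v \<and> f v \<noteq> v"
  shows "successor A v = f v"
proof (cases "f v = v")
  case True
  with assms show ?thesis by (metis successor_none)
next
  case False
  with assms have "(v, f v) \<in> A" by simp
  from successor_in[OF this] assms show ?thesis by simp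
qed

lemma wf_map_graph: "f ` V \<subseteq> V \<Longrightarrow> wf_digraph (map_graph V f)"
  by unfold_locales auto

lemma connected_map_graph:
  assumes f: "f ` V \<subseteq> V" and r: "r \<in> V" "V \<subseteq> basin f r"
  shows "Digraph_Component.connected (map_graph V f)"
proof -
  let ?S = "with_proj (mk_symmetric (map_graph V f))"
  have wfS: "wf_digraph ?S"
    using f by unfold_locales (auto simp: mk_symmetric_def)
  have arc: "(v, f v) \<in> arcs_ends ?S \<and> (f v, v) \<in> arcs_ends ?S" if "v \<in> V" "f v \<noteq> v" for v
    using that by (auto simp: mk_symmetric_def arcs_ends_conv)
  have root: "v \<rightarrow>\<^sup>*\<^bsub>?S\<^esub> r \<and> r \<rightarrow>\<^sup>*\<^bsub>?S\<^esub> v" if "v \<in> basin f r" "v \<in> V" for v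
    using that
  proof (induction rule: basin.induct)
    case base
    then show ?case using wf_digraph.reachable_refl[OF wfS, of r] by (simp add: mk_symmetric_def)
  next
    case (step v)
    show ?case
    proof (cases "f v = v")
      case False
      have "f v \<in> V" using step f by blast
      with step have *: "f v \<rightarrow>\<^sup>*\<^bsub>?S\<^esub> r" "r \<rightarrow>\<^sup>*\<^bsub>?S\<^esub> f v" by auto
      from arc[OF \<open>v \<in> V\<close> False] wf_digraph.adj_reachable_trans[OF wfS _ *(1)]
        wf_digraph.reachable_adj_trans[OF wfS *(2)]
      show ?thesis by blast
    qed (use step in auto)
  qed
  show ?thesis
    unfolding Digraph_Component.connected_def
  proof (rule strongly_connectedI)
    show "verts ?S \<noteq> {}" using r by (auto simp: mk_symmetric_def)
  next
    fix u v assume "u \<in> verts ?S" "v \<in> verts ?S"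
    then have "u \<rightarrow>\<^sup>*\<^bsub>?S\<^esub> r" "r \<rightarrow>\<^sup>*\<^bsub>?S\<^esub> v" using root r(2) by (auto simp: mk_symmetric_def)
    then show "u \<rightarrow>\<^sup>*\<^bsub>?S\<^esub> v" by (rule wf_digraph.reachable_trans[OF wfS])
  qed
qed

text \<open>
  A directed cycle would bring the orbit of one of its vertices back to that vertex.
\<close>
lemma forest_map_graph:
  assumes f: "f ` V \<subseteq> V" and r: "f r = r" "V \<subseteq> basin f r"
  shows "forest (map_graph V f)"
  unfolding forest_def
proof (rule notI, elim exE)
  let ?G = "map_graph V f"
  have ends: "arcs_ends ?G = {(v, f v) | v. v \<in> V \<and> f v \<noteq> v}"
    by (auto simp: arcs_ends_conv image_iff)
  have walk: "v \<in> basin f u" if "(v, u) \<in> (arcs_ends ?G)\<^sup>*" for u v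
    using that by (induction rule: converse_rtrancl_induct) (auto simp: ends intro: basin.base basin.step)
  fix p assume "pre_digraph.cycle ?G p"
  then obtain u where "pre_digraph.awalk ?G u p u" "p \<noteq> []"
    by (auto simp: pre_digraph.cycle_def)
  then have "(u, u) \<in> (arcs_ends ?G)\<^sup>+"
    using wf_digraph.reachable1_awalk[OF wf_map_graph[OF f]] by blast
  from tranclD[OF this] obtain w where "(u, w) \<in> arcs_ends ?G" "(w, u) \<in> (arcs_ends ?G)\<^sup>*"
    by blast
  then have "u \<in> V" "f u \<noteq> u" "f u \<in> basin f u"
    using walk[of w u] by (auto simp: ends)
  moreover from this have "u = r"
    using basin_acyclic[of u f r] r by blast
  ultimately show False using r by simp
qed

lemma rooted_tree_map_graph:
  assumes f: "f ` V \<subseteq> V" and r: "r \<in> V" "f r = r" "V \<subseteq> basin f r"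
    and V: "V \<subseteq> K" "\<And>v. v \<in> V \<Longrightarrow> f v \<noteq> v \<Longrightarrow> 0 < k v (f v)"
  shows "rooted_tree (rate_digraph K k) r (map_graph V f)"
proof -
  have out: "out_arcs (map_graph V f) v = (if f v = v then {} else {(v, f v)})" if "v \<in> V" for v
    using that by (auto simp: out_arcs_def)
  have "f v \<noteq> v" if "v \<in> V - {r}" for v
    using basin_fixed_point[of v f r] that r(3) by blast
  then have "\<forall>v\<in>V - {r}. out_degree (map_graph V f) v = 1"
    by (simp add: out_degree_def out)
  moreover have "out_degree (map_graph V f) r = 0"
    using r by (simp add: out_degree_def out)
  moreover have "subgraph (map_graph V f) (rate_digraph K k)"
    unfolding subgraph_def compatible_def using V f wf_map_graph[OF f] wf_rate_digraph[of K k]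
    by (auto simp: image_subset_iff subset_iff)
  ultimately show ?thesis
    unfolding rooted_tree_def tree_def
    using connected_map_graph[OF f r(1,3)] forest_map_graph[OF f r(2,3)] r(1) by simp
qed

text \<open>
  That all vertices reach the root follows from connectedness: the basin of the root is
  closed under passing an arc in either direction, because each vertex has a single outgoing arc
  and the root has none.
\<close>
lemma rooted_tree_successor:
  assumes K: "finite K" and T: "rooted_tree (rate_digraph K k) r T"
  defines "f \<equiv> successor (arcs T)"
  shows "T = map_graph (verts T) f" "f ` verts T \<subseteq> verts T" "r \<in> verts T" "f r = r"
    "verts T \<subseteq> basin f r" "verts T \<subseteq> K" "\<And>v. f v \<noteq> v \<Longrightarrow> 0 < k v (f v)"
proof -
  have sub: "subgraph T (rate_digraph K k)" and conn: "Digraph_Component.connected T"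
    and r: "r \<in> verts T" "out_degree T r = 0"
    and out: "\<And>v. v \<in> verts T - {r} \<Longrightarrow> out_degree T v = 1"
    using T by (auto simp: rooted_tree_def tree_def)
  have tail: "tail T = fst" and head: "head T = snd"
    using sub by (auto simp: subgraph_def compatible_def)
  have VK: "verts T \<subseteq> K" and AK: "arcs T \<subseteq> {(x, y). x \<in> K \<and> y \<in> K \<and> x \<noteq> y \<and> 0 < k x y}"
    and wf: "wf_digraph T"
    using sub unfolding subgraph_def by simp_all
  have ends: "v \<in> verts T \<and> u \<in> verts T" if "(v, u) \<in> arcs T" for u v
    using wf_digraph.tail_in_verts[OF wf that] wf_digraph.head_in_verts[OF wf that]
    by (simp add: tail head)
  have "finite (arcs T)"
    using AK K by (intro finite_subset[of "arcs T" "K \<times> K"]) auto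
  then have no_root: "(r, u) \<notin> arcs T" for u
    using r by (auto simp: out_degree_def out_arcs_def tail)
  have arc: "(v, u) \<in> arcs T \<longleftrightarrow> u = f v" if "v \<in> verts T - {r}" for u v
  proof -
    from out[OF that] obtain e where e: "out_arcs T v = {e}"
      unfolding out_degree_def by (auto simp: card_1_singleton_iff)
    have iff: "(v, u) \<in> arcs T \<longleftrightarrow> (v, u) = e" for u
    proof -
      have "(v, u) \<in> arcs T \<longleftrightarrow> (v, u) \<in> out_arcs T v" by (simp add: out_arcs_def tail)
      then show ?thesis by (simp add: e)
    qed
    have "e \<in> out_arcs T v" using e by simp
    then have "(v, snd e) \<in> arcs T" by (auto simp: out_arcs_def tail)
    then have "(v, f v) \<in> arcs T" unfolding f_def by (rule successor_in)
    with iff[of "f v"] iff[of u] show ?thesis by auto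
  qed
  show fr: "f r = r" unfolding f_def using no_root by (intro successor_none)
  have arcs_iff: "(v, u) \<in> arcs T \<longleftrightarrow> v \<in> verts T \<and> f v \<noteq> v \<and> u = f v" for u v
  proof (cases "v \<in> verts T - {r}")
    case True
    from arc[OF True, of "f v"] AK have "f v \<noteq> v" by auto
    with arc[OF True] True show ?thesis by auto
  next
    case False
    with ends no_root fr show ?thesis by auto
  qed
  show "T = map_graph (verts T) f"
    using arcs_iff tail head by (intro pre_digraph.equality) auto
  show "f ` verts T \<subseteq> verts T"
    using ends arcs_iff by (metis image_subsetI)
  show "r \<in> verts T" "verts T \<subseteq> K" by fact+
  show "0 < k v (f v)" if "f v \<noteq> v" for v
  proof -
    have "\<exists>u. (v, u) \<in> arcs T" using that unfolding f_def by (metis successor_none)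
    then have "(v, f v) \<in> arcs T" unfolding f_def by (auto intro: successor_in)
    with AK show ?thesis by auto
  qed
  show "verts T \<subseteq> basin f r"
  proof
    let ?S = "with_proj (mk_symmetric T)"
    fix v assume "v \<in> verts T"
    then have "r \<rightarrow>\<^sup>*\<^bsub>?S\<^esub> v"
      using conn r unfolding Digraph_Component.connected_def strongly_connected_def by simp
    then have "(r, v) \<in> (arcs_ends ?S)\<^sup>*" by (rule reachable_rtranclI)
    then show "v \<in> basin f r"
    proof (induction rule: rtrancl_induct)
      case base
      show ?case by (rule basin.base)
    next
      case (step x y)
      from step(2) have "(x, y) \<in> arcs T \<or> (y, x) \<in> arcs T"
        by (auto simp: mk_symmetric_def tail head arcs_ends_conv)
      with arcs_iff have "y = f x \<or> x = f y" by blast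
      with step.IH show ?case
        using basin_image[of f r x, OF fr] basin.step[of f y r] by blast
    qed
  qed
qed

lemma map_weight_arcs:
  assumes "finite V"
  shows "arcs_weight k (arcs (map_graph V f)) = map_weight V k f"
proof -
  have "arcs (map_graph V f) = (\<lambda>v. (v, f v)) ` {v \<in> V. f v \<noteq> v}" by auto
  then have "arcs_weight k (arcs (map_graph V f)) = (\<Prod>v | v \<in> V \<and> f v \<noteq> v. k v (f v))"
    unfolding arcs_weight_def by (simp add: prod.reindex inj_on_def del: map_graph_simps)
  also have "\<dots> = map_weight V k f"
    unfolding map_weight_def step_weight_def using assms
    by (intro prod.mono_neutral_cong_left) auto
  finally show ?thesis .
qed

definition positive_map :: "'a set \<Rightarrow> ('a \<Rightarrow> 'a \<Rightarrow> real) \<Rightarrow> ('a \<Rightarrow> 'a) \<Rightarrow> bool" where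
  "positive_map K k f \<longleftrightarrow> (\<forall>v\<in>K. f v \<noteq> v \<longrightarrow> 0 < k v (f v))"

lemma map_weight_nonneg:
  assumes "\<forall>x\<in>K. \<forall>y\<in>K. x \<noteq> y \<longrightarrow> 0 \<le> k x y" "f \<in> K \<rightarrow>\<^sub>E K"
  shows "0 \<le> map_weight K k f"
  unfolding map_weight_def step_weight_def using assms by (intro prod_nonneg) (auto simp: PiE_mem)

lemma map_weight_pos: "positive_map K k f \<Longrightarrow> 0 < map_weight K k f"
  unfolding map_weight_def step_weight_def positive_map_def by (intro prod_pos) simp

text \<open>
  Hence maps that use a step of rate zero may be left out of the sums.
\<close>
lemma map_weight_eq_0:
  assumes "finite K" "\<forall>x\<in>K. \<forall>y\<in>K. x \<noteq> y \<longrightarrow> 0 \<le> k x y" "f \<in> K \<rightarrow>\<^sub>E K" "\<not> positive_map K k f"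
  shows "map_weight K k f = 0"
proof -
  from assms(4) obtain v where v: "v \<in> K" "f v \<noteq> v" "\<not> 0 < k v (f v)"
    by (auto simp: positive_map_def)
  moreover have "f v \<in> K" using assms(3) v by (auto simp: PiE_mem)
  ultimately have "step_weight k v (f v) = 0"
    using assms(2) by (fastforce simp: step_weight_def)
  with v assms(1) show ?thesis unfolding map_weight_def by (intro prod_zero) auto
qed

lemma map_graph_cong: "(\<And>v. v \<in> V \<Longrightarrow> f v = g v) \<Longrightarrow> map_graph V f = map_graph V g"
  by (intro pre_digraph.equality) auto

lemma successor_map_graph:
  assumes "f \<in> K \<rightarrow>\<^sub>E K"
  shows "restrict (successor (arcs (map_graph K f))) K = f"
proof
  fix v
  show "restrict (successor (arcs (map_graph K f))) K v = f v"
  proof (cases "v \<in> K")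
    case True
    then have "successor (arcs (map_graph K f)) v = f v"
      by (intro successor_graph) auto
    with True show ?thesis by simp
  next
    case False
    with PiE_arb[OF assms False] show ?thesis by simp
  qed
qed

lemma successor_Un_left: "(\<And>u. (v, u) \<notin> B) \<Longrightarrow> successor (A \<union> B) v = successor A v"
  and successor_Un_right: "(\<And>u. (v, u) \<notin> A) \<Longrightarrow> successor (A \<union> B) v = successor B v"
  by (simp_all add: successor_def)

lemma tree_weight_eq:
  assumes K: "finite K" and z: "z \<in> K" and nonneg: "\<forall>x\<in>K. \<forall>y\<in>K. x \<noteq> y \<longrightarrow> 0 \<le> k x y"
  shows "tree_weight K k z = (\<Sum>f\<in>tree_maps K z. map_weight K k f)"
proof -
  let ?P = "{f \<in> tree_maps K z. positive_map K k f}"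
  have "tree_weight K k z = (\<Sum>f\<in>?P. map_weight K k f)"
    unfolding tree_weight_def
  proof (rule sum.reindex_bij_witness[where i = "map_graph K" and j = "\<lambda>T. restrict (successor (arcs T)) K"])
    fix T assume "T \<in> spanning_rooted_trees (rate_digraph K k) z"
    then have T: "rooted_tree (rate_digraph K k) z T" and V: "verts T = K"
      by (auto simp: spanning_rooted_trees_def spanning_def)
    note * = rooted_tree_successor[OF K T, unfolded V]
    let ?f = "successor (arcs T)" let ?g = "restrict ?f K"
    have g: "?g v = ?f v" if "v \<in> K" for v using that by simp
    show T_eq: "map_graph K ?g = T"
      using *(1) map_graph_cong[of K ?g ?f] by simp
    have "K \<subseteq> basin ?g z"
    proof
      fix v assume v: "v \<in> K"
      with *(5) have "v \<in> basin ?f z" by blast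
      from this v *(2) g show "v \<in> basin ?g z" by (rule basin_cong)
    qed
    moreover have "?g \<in> K \<rightarrow>\<^sub>E K" using *(2) by auto
    ultimately show "?g \<in> ?P"
      using *(4,7) z by (auto simp: positive_map_def intro!: tree_mapsI)
    show "map_weight K k ?g = arcs_weight k (arcs T)"
      using map_weight_arcs[OF K, of k ?g] T_eq by simp
  next
    fix f assume f: "f \<in> ?P"
    then have fK: "f \<in> K \<rightarrow>\<^sub>E K" and fz: "f z = z" "K \<subseteq> basin f z"
      by (auto simp: tree_maps_def)
    show "restrict (successor (arcs (map_graph K f))) K = f"
      using fK by (rule successor_map_graph)
    have "rooted_tree (rate_digraph K k) z (map_graph K f)"
      using f fz z fK by (intro rooted_tree_map_graph) (auto simp: positive_map_def)
    then show "map_graph K f \<in> spanning_rooted_trees (rate_digraph K k) z"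
      by (auto simp: spanning_rooted_trees_def spanning_def rooted_tree_def)
  qed
  also have "\<dots> = (\<Sum>f\<in>tree_maps K z. map_weight K k f)"
    using K nonneg
    by (intro sum.mono_neutral_left finite_maps ballI map_weight_eq_0) (auto simp: tree_maps_def)
  finally show ?thesis .
qed

text \<open>
  The two trees are read off the map as the basin of \<open>z\<close> and its complement.
\<close>
lemma two_tree_forest_map:
  assumes K: "finite K" and F: "(S, T) \<in> two_tree_forests (rate_digraph K k) x z"
  defines "g \<equiv> restrict (successor (arcs S \<union> arcs T)) K"
  shows "g \<in> forest_maps K x z" "positive_map K k g"
    "map_graph (K - basin g z) g = S" "map_graph (K \<inter> basin g z) g = T"
proof -
  from F obtain r where S: "rooted_tree (rate_digraph K k) r S" and T: "rooted_tree (rate_digraph K k) z T"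
    and x: "x \<in> verts S" and disj: "verts S \<inter> verts T = {}" and un: "verts S \<union> verts T = K"
    by (auto simp: two_tree_forests_def)
  note S' = rooted_tree_successor[OF K S] and T' = rooted_tree_successor[OF K T]
  have arcsS: "v \<in> verts S" if "(v, u) \<in> arcs S" for v u
    using that by (subst (asm) S'(1)) auto
  have arcsT: "v \<in> verts T" if "(v, u) \<in> arcs T" for v u
    using that by (subst (asm) T'(1)) auto
  have gS: "g v = successor (arcs S) v" if "v \<in> verts S" for v
    unfolding g_def using that disj un arcsT by (subst restrict_apply', blast) (rule successor_Un_left, blast)
  have gT: "g v = successor (arcs T) v" if "v \<in> verts T" for v
    unfolding g_def using that disj un arcsS by (subst restrict_apply', blast) (rule successor_Un_right, blast)
  have gr: "g r = r" "g z = z" using gS gT S' T' by simp_all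
  have S_basin: "verts S \<subseteq> basin g r"
    using basin_cong[OF _ _ S'(2) gS] S'(5) by blast
  have T_basin: "verts T \<subseteq> basin g z"
    using basin_cong[OF _ _ T'(2) gT] T'(5) by blast
  have "r \<noteq> z" using S'(3) T'(3) disj by blast
  then have S_not: "v \<notin> basin g z" if "v \<in> verts S" for v
    using basin_unique[of v g r z] S_basin gr that by blast
  have gK: "g \<in> K \<rightarrow>\<^sub>E K"
  proof (rule PiE_I)
    fix v assume "v \<in> K"
    then have "g v \<in> verts S \<union> verts T"
      using un gS gT S'(2) T'(2) by (metis UnE UnI1 UnI2 image_subset_iff)
    then show "g v \<in> K" using un by simp
  qed (simp add: g_def)
  have "K \<subseteq> basin g z \<union> basin g r" "r \<in> K" "x \<in> basin g r"
    using S_basin T_basin un S'(3) x by blast+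
  with gK gr \<open>r \<noteq> z\<close> show "g \<in> forest_maps K x z"
    by (intro forest_mapsI[of _ _ _ r])
  show "positive_map K k g"
    unfolding positive_map_def
  proof (intro ballI impI)
    fix v assume "v \<in> K" "g v \<noteq> v"
    with un consider "v \<in> verts S" | "v \<in> verts T" by blast
    then show "0 < k v (g v)"
      using S'(7)[of v] T'(7)[of v] gS[of v] gT[of v] \<open>g v \<noteq> v\<close> by cases simp_all
  qed
  have "K - basin g z = verts S" "K \<inter> basin g z = verts T"
    using un S_not T_basin by blast+
  then show "map_graph (K - basin g z) g = S" "map_graph (K \<inter> basin g z) g = T"
    using S'(1) T'(1) map_graph_cong[of _ g, OF gS] map_graph_cong[of _ g, OF gT] by simp_all
qed

lemma forest_map_two_trees:
  assumes z: "z \<in> K" and x: "x \<in> K" and f: "f \<in> forest_maps K x z" and pos: "positive_map K k f"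
  shows "(map_graph (K - basin f z) f, map_graph (K \<inter> basin f z) f)
           \<in> two_tree_forests (rate_digraph K k) x z"
proof -
  from f obtain r where fK: "f \<in> K \<rightarrow>\<^sub>E K" and fz: "f z = z" and r: "r \<in> K" "f r = r" "r \<noteq> z"
      "x \<in> basin f r" "K \<subseteq> basin f z \<union> basin f r"
    by (elim forest_mapsE)
  have fv: "f v \<in> K" if "v \<in> K" for v using fK that by auto
  have "rooted_tree (rate_digraph K k) r (map_graph (K - basin f z) f)"
  proof (rule rooted_tree_map_graph)
    show "f ` (K - basin f z) \<subseteq> K - basin f z" using fv by (auto intro: basin.step)
    show "r \<in> K - basin f z" using r basin_fixed_point[of r f z] by blast
  qed (use r pos in \<open>auto simp: positive_map_def\<close>)
  moreover have "rooted_tree (rate_digraph K k) z (map_graph (K \<inter> basin f z) f)"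
  proof (rule rooted_tree_map_graph)
    show "f ` (K \<inter> basin f z) \<subseteq> K \<inter> basin f z" using fv basin_image[of f z, OF fz] by blast
  qed (use z fz pos in \<open>auto simp: positive_map_def intro: basin.base\<close>)
  moreover have "x \<notin> basin f z" using f by (rule forest_map_not_in_basin)
  ultimately show ?thesis using x by (auto simp: two_tree_forests_def)
qed

lemma arcs_map_graph_split:
  "arcs (map_graph (K - B) f) \<union> arcs (map_graph (K \<inter> B) f) = arcs (map_graph K f)"
  by auto

lemma forest_weight_eq:
  assumes K: "finite K" and z: "z \<in> K" and x: "x \<in> K"
    and nonneg: "\<forall>x\<in>K. \<forall>y\<in>K. x \<noteq> y \<longrightarrow> 0 \<le> k x y"
  shows "forest_weight K k x z = (\<Sum>f\<in>forest_maps K x z. map_weight K k f)"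
proof -
  let ?P = "{f \<in> forest_maps K x z. positive_map K k f}"
  have "forest_weight K k x z = (\<Sum>f\<in>?P. map_weight K k f)"
    unfolding forest_weight_def
  proof (rule sum.reindex_bij_witness[where
        i = "\<lambda>f. (map_graph (K - basin f z) f, map_graph (K \<inter> basin f z) f)" and
        j = "\<lambda>(S, T). restrict (successor (arcs S \<union> arcs T)) K"])
    fix F assume "F \<in> two_tree_forests (rate_digraph K k) x z"
    then obtain S T where F: "F = (S, T)" "(S, T) \<in> two_tree_forests (rate_digraph K k) x z"
      by (cases F) auto
    let ?j = "\<lambda>(S, T). restrict (successor (arcs S \<union> arcs T)) K"
    let ?g = "restrict (successor (arcs S \<union> arcs T)) K"
    have jF: "?j F = ?g" using F by simp
    note * = two_tree_forest_map[OF K F(2)]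
    show "(map_graph (K - basin (?j F) z) (?j F), map_graph (K \<inter> basin (?j F) z) (?j F)) = F"
      unfolding jF using * F by simp
    show "?j F \<in> ?P" unfolding jF using * by simp
    show "map_weight K k (?j F) = (case F of (S, T) \<Rightarrow> arcs_weight k (arcs S \<union> arcs T))"
    proof -
      have "arcs S \<union> arcs T = arcs (map_graph K ?g)"
        using *(3,4) arcs_map_graph_split[of K "basin ?g z" ?g] by simp
      then have "arcs_weight k (arcs S \<union> arcs T) = map_weight K k ?g"
        using map_weight_arcs[OF K, of k ?g] by simp
      then show ?thesis using F by simp
    qed
  next
    fix f assume f: "f \<in> ?P"
    then have "f \<in> K \<rightarrow>\<^sub>E K" by (auto simp: forest_maps_def)
    then show "(case (map_graph (K - basin f z) f, map_graph (K \<inter> basin f z) f) of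
        (S, T) \<Rightarrow> restrict (successor (arcs S \<union> arcs T)) K) = f"
      by (simp only: prod.case arcs_map_graph_split successor_map_graph)
    show "(map_graph (K - basin f z) f, map_graph (K \<inter> basin f z) f)
           \<in> two_tree_forests (rate_digraph K k) x z"
      using f by (intro forest_map_two_trees[OF z x]) auto
  qed
  also have "\<dots> = (\<Sum>f\<in>forest_maps K x z. map_weight K k f)"
    using K nonneg
    by (intro sum.mono_neutral_left finite_maps ballI map_weight_eq_0) (auto simp: forest_maps_def)
  finally show ?thesis .
qed

section \<open>Irreducibility: positive tree weight and uniqueness\<close>

lemma irreducible_rates_path:
  assumes "irreducible_rates K k" "x \<in> K" "z \<in> K"
  shows "(x, z) \<in> {(x, y). x \<in> K \<and> y \<in> K \<and> x \<noteq> y \<and> 0 < k x y}\<^sup>*"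
proof -
  have "arcs_ends (rate_digraph K k) = {(x, y). x \<in> K \<and> y \<in> K \<and> x \<noteq> y \<and> 0 < k x y}"
    by (auto simp: arcs_ends_conv)
  moreover have "x \<rightarrow>\<^sup>*\<^bsub>rate_digraph K k\<^esub> z"
    using assms by (auto simp: irreducible_rates_def strongly_connected_def)
  ultimately show ?thesis using reachable_rtranclI by metis
qed

text \<open>
  Every vertex steps to a neighbour that is closer to \<open>z\<close>, as in a breadth-first search tree.
\<close>
lemma positive_tree_map_exists:
  assumes irr: "irreducible_rates K k" and z: "z \<in> K"
  shows "\<exists>f\<in>tree_maps K z. positive_map K k f"
proof -
  define R where "R = {(x, y). x \<in> K \<and> y \<in> K \<and> x \<noteq> y \<and> 0 < k x y}"
  define d where "d v = (LEAST n. (v, z) \<in> R ^^ n)" for v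
  have dist: "(v, z) \<in> R ^^ d v" if "v \<in> K" for v
  proof -
    have "(v, z) \<in> R\<^sup>*" unfolding R_def using irr that z by (rule irreducible_rates_path)
    then obtain n where "(v, z) \<in> R ^^ n" by (auto dest: rtrancl_imp_relpow)
    then show ?thesis unfolding d_def by (rule LeastI)
  qed
  have closer: "\<exists>u. (v, u) \<in> R \<and> d u < d v" if v: "v \<in> K" "v \<noteq> z" for v
  proof (cases "d v")
    case 0
    with dist[OF v(1)] v show ?thesis by simp
  next
    case (Suc m)
    with dist[OF v(1)] have "(v, z) \<in> R ^^ Suc m" by simp
    then obtain u where u: "(v, u) \<in> R" "(u, z) \<in> R ^^ m" by (blast dest: relpow_Suc_D2)
    from u(2) have "d u \<le> m" unfolding d_def by (rule Least_le)
    with u Suc show ?thesis by auto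
  qed
  define f where "f = restrict (\<lambda>v. if v = z then z else SOME u. (v, u) \<in> R \<and> d u < d v) K"
  have f: "(v, f v) \<in> R \<and> d (f v) < d v" if "v \<in> K" "v \<noteq> z" for v
    using someI_ex[OF closer[OF that]] that by (simp add: f_def)
  have fz: "f z = z" using z by (simp add: f_def)
  have "v \<in> basin f z" if "v \<in> K" for v
    using that
  proof (induction "d v" arbitrary: v rule: less_induct)
    case less
    show ?case
    proof (cases "v = z")
      case False
      with less.prems f[of v] have "d (f v) < d v" "f v \<in> K" by (auto simp: R_def)
      then have "f v \<in> basin f z" by (rule less.hyps)
      then show ?thesis by (rule basin.step)
    qed (simp add: basin.base)
  qed
  moreover have "f \<in> K \<rightarrow>\<^sub>E K"
    using f z fz by (intro PiE_I) (auto simp: R_def, auto simp: f_def)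
  moreover have "positive_map K k f"
    unfolding positive_map_def using f fz by (auto simp: R_def)
  ultimately show ?thesis using fz by (auto intro!: tree_mapsI)
qed

lemma tree_weight_pos:
  assumes K: "finite K" and nonneg: "\<forall>x\<in>K. \<forall>y\<in>K. x \<noteq> y \<longrightarrow> 0 \<le> k x y"
    and irr: "irreducible_rates K k" and z: "z \<in> K"
  shows "0 < tree_weight K k z"
proof -
  from positive_tree_map_exists[OF irr z] obtain f where f: "f \<in> tree_maps K z" "positive_map K k f"
    by blast
  have "0 < (\<Sum>f\<in>tree_maps K z. map_weight K k f)"
    using f K map_weight_nonneg[OF nonneg] map_weight_pos[OF f(2)]
    by (intro sum_pos2[of _ f]) (auto simp: finite_maps, auto simp: tree_maps_def)
  then show ?thesis using tree_weight_eq[OF K z nonneg] by simp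
qed

text \<open>
  The maximum principle: at a maximum point other than \<open>z\<close> all neighbours are maximum points as
  well, so by irreducibility the maximum is attained at \<open>z\<close>.
\<close>
lemma subharmonic_le_boundary:
  fixes h :: "'a \<Rightarrow> real"
  assumes K: "finite K" and nonneg: "\<forall>x\<in>K. \<forall>y\<in>K. x \<noteq> y \<longrightarrow> 0 \<le> k x y"
    and irr: "irreducible_rates K k" and z: "z \<in> K"
    and h: "\<And>x. x \<in> K \<Longrightarrow> x \<noteq> z \<Longrightarrow> 0 \<le> (\<Sum>y\<in>K. k x y * (h y - h x))"
    and x: "x \<in> K"
  shows "h x \<le> h z"
proof -
  have "Max (h ` K) \<in> h ` K" using K z by (intro Max_in) auto
  then obtain m where m: "m \<in> K" "Max (h ` K) = h m" by auto
  have max: "h y \<le> h m" if "y \<in> K" for y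
    using that K m(2) by (metis Max_ge finite_imageI imageI)
  have along: "h v = h m \<or> h z = h m"
    if "(m, v) \<in> {(x, y). x \<in> K \<and> y \<in> K \<and> x \<noteq> y \<and> 0 < k x y}\<^sup>*" for v
    using that
  proof (induction rule: rtrancl_induct)
    case (step u v)
    show ?case
    proof (cases "h z = h m")
      case False
      with step have u: "h u = h m" "u \<noteq> z" "u \<in> K" and v: "v \<in> K" "0 < k u v" by auto
      have term_nonneg: "0 \<le> k u y * (h m - h y)" if "y \<in> K" for y
      proof (cases "y = u")
        case False
        with nonneg u that max[OF that] show ?thesis by (intro mult_nonneg_nonneg) auto
      qed (use u in simp)
      have "0 \<le> - (\<Sum>y\<in>K. k u y * (h m - h y))"
        using h[OF u(3,2)] u(1) by (simp add: sum_negf[symmetric] algebra_simps)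
      moreover have "0 \<le> (\<Sum>y\<in>K. k u y * (h m - h y))"
        using term_nonneg by (rule sum_nonneg)
      ultimately have "(\<Sum>y\<in>K. k u y * (h m - h y)) = 0" by simp
      then have "k u v * (h m - h v) = 0"
        using sum_nonneg_eq_0_iff[OF K, of "\<lambda>y. k u y * (h m - h y)"] term_nonneg v(1) by blast
      with v show ?thesis by simp
    qed simp
  qed simp
  have "h z = h m" using along[OF irreducible_rates_path[OF irr m(1) z]] by simp
  with max[OF x] show ?thesis by simp
qed

lemma first_passage_equations_iff:
  assumes K: "finite K" and nonneg: "\<forall>x\<in>K. \<forall>y\<in>K. x \<noteq> y \<longrightarrow> 0 \<le> k x y"
    and irr: "irreducible_rates K k"
  shows "first_passage_equations K k \<tau> \<longleftrightarrow>
    (\<forall>x\<in>K. \<forall>z\<in>K. \<tau> x z = (if x = z then 0 else forest_weight K k x z / tree_weight K k z))"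
proof -
  define \<sigma> where "\<sigma> x z = (if x = z then 0 else forest_weight K k x z / tree_weight K k z)" for x z
  have solves: "(\<Sum>y\<in>K. k x y * (\<sigma> y z - \<sigma> x z)) + 1 = 0" if "x \<in> K" "z \<in> K" "x \<noteq> z" for x z
  proof -
    have pos: "0 < tree_weight K k z" using tree_weight_pos[OF K nonneg irr \<open>z \<in> K\<close>] .
    have \<sigma>: "\<sigma> y z = (\<Sum>f\<in>forest_maps K y z. map_weight K k f) / tree_weight K k z" if "y \<in> K" for y
      using forest_weight_eq[OF K \<open>z \<in> K\<close> that nonneg] by (simp add: \<sigma>_def forest_maps_same)
    have "(\<Sum>y\<in>K. k x y * (\<sigma> y z - \<sigma> x z)) =
        (\<Sum>y\<in>K. k x y * ((\<Sum>f\<in>forest_maps K y z. map_weight K k f) -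
          (\<Sum>f\<in>forest_maps K x z. map_weight K k f))) / tree_weight K k z"
      unfolding sum_divide_distrib using \<sigma> \<open>x \<in> K\<close>
      by (intro sum.cong) (simp_all flip: diff_divide_distrib)
    also have "\<dots> = - 1"
      using forest_maps_equation[OF K \<open>x \<in> K\<close> \<open>x \<noteq> z\<close>, of k] pos
        tree_weight_eq[OF K \<open>z \<in> K\<close> nonneg]
      by (simp add: field_simps)
    finally show ?thesis by simp
  qed
  have unique: "\<tau> x z \<le> \<tau>' x z"
    if \<tau>: "first_passage_equations K k \<tau>" and \<tau>': "first_passage_equations K k \<tau>'"
      and x: "x \<in> K" and z: "z \<in> K" for \<tau> \<tau>' x z
  proof -
    define h where "h y = \<tau> y z - \<tau>' y z" for y
    have "h x \<le> h z"
    proof (rule subharmonic_le_boundary[OF K nonneg irr z _ x])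
      fix u assume u: "u \<in> K" "u \<noteq> z"
      have "(\<Sum>y\<in>K. k u y * (h y - h u)) =
          (\<Sum>y\<in>K. k u y * (\<tau> y z - \<tau> u z)) - (\<Sum>y\<in>K. k u y * (\<tau>' y z - \<tau>' u z))"
        unfolding sum_subtractf[symmetric] h_def by (intro sum.cong) (auto simp: algebra_simps)
      moreover have "(\<Sum>y\<in>K. k u y * (\<tau> y z - \<tau> u z)) + 1 = 0"
        "(\<Sum>y\<in>K. k u y * (\<tau>' y z - \<tau>' u z)) + 1 = 0"
        using \<tau> \<tau>' u z by (simp_all add: first_passage_equations_def)
      ultimately show "0 \<le> (\<Sum>y\<in>K. k u y * (h y - h u))" by linarith
    qed
    then show ?thesis using \<tau> \<tau>' z by (simp add: h_def first_passage_equations_def)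
  qed
  have \<sigma>_eq: "first_passage_equations K k \<sigma>"
    unfolding first_passage_equations_def using solves by (auto simp: \<sigma>_def)
  have cong: "first_passage_equations K k \<tau>" if "\<forall>x\<in>K. \<forall>z\<in>K. \<tau> x z = \<sigma> x z"
  proof -
    have "(\<Sum>y\<in>K. k x y * (\<tau> y z - \<tau> x z)) = (\<Sum>y\<in>K. k x y * (\<sigma> y z - \<sigma> x z))"
      if "x \<in> K" "z \<in> K" for x z
      using that \<open>\<forall>x\<in>K. \<forall>z\<in>K. \<tau> x z = \<sigma> x z\<close> by (intro sum.cong) auto
    with that \<sigma>_eq show ?thesis by (simp add: first_passage_equations_def)
  qed
  have "first_passage_equations K k \<tau> \<longleftrightarrow> (\<forall>x\<in>K. \<forall>z\<in>K. \<tau> x z = \<sigma> x z)"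
    using cong unique[OF _ \<sigma>_eq] unique[OF \<sigma>_eq] by (blast intro: order.antisym)
  then show ?thesis by (simp only: \<sigma>_def)
qed

section \<open>Killed chains and hitting times on a grid\<close>

text \<open>
  A discrete form of Dynkin's formula. Here \<open>q j\<close> is the distribution at time \<open>j\<close> of a chain on
  \<open>A\<close> that is killed on leaving \<open>A\<close>, so that the double sum is the expected number of steps before killing. The quantity
  \<open>\<Sum>y. q j y * h y\<close> drops in each step by \<open>\<delta>\<close> times the surviving mass, up to a relative error
  \<open>\<epsilon>\<close>; it tends to zero because the masses are summable.
\<close>
lemma killed_chain_occupation:
  fixes q :: "nat \<Rightarrow> 'a \<Rightarrow> real" and p h :: "'a \<Rightarrow> real" and P :: "'a \<Rightarrow> 'a \<Rightarrow> real"
  assumes A: "finite A" and q: "\<And>j y. y \<in> A \<Longrightarrow> 0 \<le> q j y" and h: "\<And>y. y \<in> A \<Longrightarrow> 0 \<le> h y"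
    and step: "\<And>j v. v \<in> A \<Longrightarrow> q (Suc j) v = (\<Sum>y\<in>A. q j y * P y v)"
    and drift: "\<And>y. y \<in> A \<Longrightarrow> \<bar>(\<Sum>v\<in>A. P y v * h v) - h y + \<delta>\<bar> \<le> \<epsilon> * \<delta>"
    and pos: "0 < \<delta>" "0 \<le> \<epsilon>" "\<epsilon> < 1"
  defines "a \<equiv> \<Sum>y\<in>A. q 0 y * h y"
  shows "summable (\<lambda>j. \<Sum>y\<in>A. q j y)"
    and "(1 - \<epsilon>) * (\<delta> * (\<Sum>j. \<Sum>y\<in>A. q j y)) \<le> a"
    and "a \<le> (1 + \<epsilon>) * (\<delta> * (\<Sum>j. \<Sum>y\<in>A. q j y))"
proof -
  define s where "s j = (\<Sum>y\<in>A. q j y)" for j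
  define b where "b j = (\<Sum>y\<in>A. q j y * h y)" for j
  have s_nonneg: "0 \<le> s j" for j unfolding s_def using q by (intro sum_nonneg)
  have b_nonneg: "0 \<le> b j" for j unfolding b_def using q h by (intro sum_nonneg mult_nonneg_nonneg)
  have drop: "b j - b (Suc j) = (\<Sum>y\<in>A. q j y * (h y - (\<Sum>v\<in>A. P y v * h v)))" for j
  proof -
    have "b (Suc j) = (\<Sum>v\<in>A. \<Sum>y\<in>A. q j y * P y v * h v)"
      unfolding b_def by (intro sum.cong) (simp_all add: step sum_distrib_right)
    also have "\<dots> = (\<Sum>y\<in>A. q j y * (\<Sum>v\<in>A. P y v * h v))"
      by (subst sum.swap) (simp add: sum_distrib_left mult.assoc)
    finally show ?thesis
      unfolding b_def by (simp add: right_diff_distrib sum_subtractf)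
  qed
  have lower: "(1 - \<epsilon>) * \<delta> * s j \<le> b j - b (Suc j)" for j
    unfolding drop s_def sum_distrib_left
  proof (intro sum_mono)
    fix y assume y: "y \<in> A"
    have "(1 - \<epsilon>) * \<delta> \<le> h y - (\<Sum>v\<in>A. P y v * h v)"
      using drift[OF y] by (simp add: algebra_simps abs_le_iff)
    from mult_left_mono[OF this q[OF y, of j]]
    show "(1 - \<epsilon>) * \<delta> * q j y \<le> q j y * (h y - (\<Sum>v\<in>A. P y v * h v))"
      by (simp add: mult.commute)
  qed
  have upper: "b j - b (Suc j) \<le> (1 + \<epsilon>) * \<delta> * s j" for j
    unfolding drop s_def sum_distrib_left
  proof (intro sum_mono)
    fix y assume y: "y \<in> A"
    have "h y - (\<Sum>v\<in>A. P y v * h v) \<le> (1 + \<epsilon>) * \<delta>"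
      using drift[OF y] by (simp add: algebra_simps abs_le_iff)
    from mult_left_mono[OF this q[OF y, of j]]
    show "q j y * (h y - (\<Sum>v\<in>A. P y v * h v)) \<le> (1 + \<epsilon>) * \<delta> * q j y"
      by (simp add: mult.commute)
  qed
  have tele: "(\<Sum>j<n. b j - b (Suc j)) = b 0 - b n" for n
    using sum_lessThan_telescope'[of b n] .
  have partial: "(1 - \<epsilon>) * \<delta> * (\<Sum>j<n. s j) \<le> b 0" for n
  proof -
    have "(1 - \<epsilon>) * \<delta> * (\<Sum>j<n. s j) \<le> b 0 - b n"
      unfolding tele[symmetric] sum_distrib_left using lower by (rule sum_mono)
    with b_nonneg[of n] show ?thesis by simp
  qed
  have c: "0 < (1 - \<epsilon>) * \<delta>" using pos by simp
  have bound: "(\<Sum>j<n. s j) \<le> b 0 / ((1 - \<epsilon>) * \<delta>)" for n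
    using partial[of n] c by (simp add: pos_le_divide_eq mult.commute)
  have sums: "summable s"
    using s_nonneg bound by (rule summableI_nonneg_bounded)
  then show "summable (\<lambda>j. \<Sum>y\<in>A. q j y)" by (simp add: s_def[abs_def])
  have ab: "a = b 0" by (simp add: a_def b_def)
  have "suminf s \<le> b 0 / ((1 - \<epsilon>) * \<delta>)"
    using sums bound by (rule suminf_le_const)
  then have "(1 - \<epsilon>) * (\<delta> * suminf s) \<le> a"
    using c by (simp add: pos_le_divide_eq ab mult_ac)
  then show "(1 - \<epsilon>) * (\<delta> * (\<Sum>j. \<Sum>y\<in>A. q j y)) \<le> a" by (simp add: s_def[abs_def])
  define H where "H = (\<Sum>y\<in>A. h y)"
  have hH: "h y \<le> H" if "y \<in> A" for y
    unfolding H_def using A h that by (intro member_le_sum) auto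
  have "b n \<le> H * s n" for n
    unfolding b_def s_def sum_distrib_left
    using hH q by (intro sum_mono) (simp add: mult.commute mult_right_mono)
  moreover have "(\<lambda>n. H * s n) \<longlonglongrightarrow> 0"
    using tendsto_mult_right_zero[OF summable_LIMSEQ_zero[OF sums], of H] .
  ultimately have "b \<longlonglongrightarrow> 0"
    using b_nonneg by (intro tendsto_sandwich[of "\<lambda>_. 0" b sequentially "\<lambda>n. H * s n" 0]) auto
  then have "(\<lambda>n. b 0 - b n) \<longlonglongrightarrow> b 0 - 0" by (intro tendsto_intros)
  moreover have "b 0 - b n \<le> (1 + \<epsilon>) * \<delta> * suminf s" for n
  proof -
    have "b 0 - b n \<le> (1 + \<epsilon>) * \<delta> * (\<Sum>j<n. s j)"
      unfolding tele[symmetric] sum_distrib_left using upper by (rule sum_mono)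
    also have "\<dots> \<le> (1 + \<epsilon>) * \<delta> * suminf s"
      using pos sum_le_suminf[OF sums, of "{..<n}"] s_nonneg by (intro mult_left_mono) auto
    finally show ?thesis .
  qed
  ultimately have "b 0 \<le> (1 + \<epsilon>) * \<delta> * suminf s"
    by (intro LIMSEQ_le_const2) auto
  then show "a \<le> (1 + \<epsilon>) * (\<delta> * (\<Sum>j. \<Sum>y\<in>A. q j y))"
    by (simp add: ab s_def[abs_def] mult.assoc)
qed

definition grid_time :: "(real \<Rightarrow> 'w \<Rightarrow> 'a) \<Rightarrow> 'a \<Rightarrow> real \<Rightarrow> 'w \<Rightarrow> ennreal" where
  "grid_time X z \<delta> \<omega> = Inf {ennreal (real j * \<delta>) | j. X (real j * \<delta>) \<omega> = z}"

text \<open>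
  Layer-cake form, whose expectation needs only the probabilities that the first grid points avoid \<open>z\<close>.
\<close>
lemma grid_time_eq_suminf:
  assumes "0 < \<delta>"
  shows "grid_time X z \<delta> \<omega> =
    (\<Sum>j. ennreal \<delta> * indicator {\<omega>. \<forall>i\<le>j. X (real i * \<delta>) \<omega> \<noteq> z} \<omega>)"
proof (cases "\<exists>j. X (real j * \<delta>) \<omega> = z")
  case False
  then have "(\<Sum>j. ennreal \<delta> * indicator {\<omega>. \<forall>i\<le>j. X (real i * \<delta>) \<omega> \<noteq> z} \<omega>) = (\<Sum>j::nat. ennreal \<delta>)"
    by (intro suminf_cong) simp
  also have "\<dots> = top"
  proof (rule ccontr)
    assume "(\<Sum>j::nat. ennreal \<delta>) \<noteq> top"
    then have "summable (\<lambda>j::nat. \<delta>)" using assms by (intro summable_suminf_not_top) auto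
    then show False using assms by (simp add: summable_const_iff)
  qed
  finally have "(\<Sum>j. ennreal \<delta> * indicator {\<omega>. \<forall>i\<le>j. X (real i * \<delta>) \<omega> \<noteq> z} \<omega>) = top" .
  moreover have "grid_time X z \<delta> \<omega> = top" using False by (simp add: grid_time_def)
  ultimately show ?thesis by (simp only:)
next
  case True
  define N where "N = (LEAST j. X (real j * \<delta>) \<omega> = z)"
  have N: "X (real N * \<delta>) \<omega> = z" unfolding N_def using True by (rule LeastI_ex)
  have least: "N \<le> j" if "X (real j * \<delta>) \<omega> = z" for j
    unfolding N_def using that by (rule Least_le)
  have "indicator {\<omega>. \<forall>i\<le>j. X (real i * \<delta>) \<omega> \<noteq> z} \<omega> = (if j < N then 1 else 0 :: ennreal)" for j
  proof (cases "j < N")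
    case True
    then have "X (real i * \<delta>) \<omega> \<noteq> z" if "i \<le> j" for i using least[of i] that by auto
    with True show ?thesis by simp
  next
    case False
    with N have "\<exists>i\<le>j. X (real i * \<delta>) \<omega> = z" by (intro exI[of _ N]) simp
    with False show ?thesis by (simp add: indicator_def)
  qed
  then have "(\<Sum>j. ennreal \<delta> * indicator {\<omega>. \<forall>i\<le>j. X (real i * \<delta>) \<omega> \<noteq> z} \<omega>) =
      (\<Sum>j. if j < N then ennreal \<delta> else 0)"
    by (intro suminf_cong) simp
  also have "\<dots> = (\<Sum>j<N. if j < N then ennreal \<delta> else 0)"
    by (intro suminf_finite) auto
  also have "\<dots> = ennreal (real N * \<delta>)"
    using assms by (simp add: ennreal_mult ennreal_of_nat_eq_real_of_nat)
  also have "\<dots> = grid_time X z \<delta> \<omega>"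
    unfolding grid_time_def
  proof (intro order.antisym Inf_greatest)
    show "Inf {ennreal (real j * \<delta>) |j. X (real j * \<delta>) \<omega> = z} \<le> ennreal (real N * \<delta>)"
      using N by (intro Inf_lower) auto
  next
    fix t assume "t \<in> {ennreal (real j * \<delta>) |j. X (real j * \<delta>) \<omega> = z}"
    then show "ennreal (real N * \<delta>) \<le> t"
      using least assms by (auto intro!: ennreal_leI mult_right_mono)
  qed
  finally show ?thesis by simp
qed

lemma grid_time_refine:
  assumes "0 < m"
  shows "grid_time X z (\<delta> / real m) \<omega> \<le> grid_time X z \<delta> \<omega>"
  unfolding grid_time_def
proof (intro Inf_superset_mono subsetI)
  fix t assume "t \<in> {ennreal (real j * \<delta>) |j. X (real j * \<delta>) \<omega> = z}"
  then obtain j where "t = ennreal (real j * \<delta>)" "X (real j * \<delta>) \<omega> = z" by blast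
  moreover have "real (j * m) * (\<delta> / real m) = real j * \<delta>" using assms by simp
  ultimately show "t \<in> {ennreal (real j * (\<delta> / real m)) |j. X (real j * (\<delta> / real m)) \<omega> = z}"
    by (intro CollectI exI[of _ "j * m"]) simp
qed

text \<open>
  By right-continuity every visit to \<open>z\<close> lasts for a positive time, so a sufficiently fine grid sees it with
  a delay of at most one mesh width.
\<close>
lemma first_passage_time_eq_INF_grid_time:
  assumes right: "\<And>t. 0 \<le> t \<Longrightarrow> eventually (\<lambda>s. X s \<omega> = X t \<omega>) (at_right t)"
    and \<delta>: "\<And>n. 0 < \<delta> n" "\<delta> \<longlonglongrightarrow> 0"
  shows "first_passage_time X z \<omega> = (INF n. grid_time X z (\<delta> n) \<omega>)"
proof (rule order.antisym)
  show "first_passage_time X z \<omega> \<le> (INF n. grid_time X z (\<delta> n) \<omega>)"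
  proof (rule INF_greatest)
    fix n
    have "0 \<le> real j * \<delta> n" for j using \<delta>(1)[of n] by simp
    then show "first_passage_time X z \<omega> \<le> grid_time X z (\<delta> n) \<omega>"
      unfolding first_passage_time_def grid_time_def by (intro Inf_superset_mono) blast
  qed
next
  show "(INF n. grid_time X z (\<delta> n) \<omega>) \<le> first_passage_time X z \<omega>"
    unfolding first_passage_time_def
  proof (rule Inf_greatest)
    fix T assume "T \<in> {ennreal t |t. 0 \<le> t \<and> X t \<omega> = z}"
    then obtain t where t: "T = ennreal t" "0 \<le> t" "X t \<omega> = z" by blast
    from right[OF t(2)] obtain c where c: "c > t" "\<And>s. t < s \<Longrightarrow> s < c \<Longrightarrow> X s \<omega> = z"
      by (auto simp: eventually_at_right_field t(3))
    show "(INF n. grid_time X z (\<delta> n) \<omega>) \<le> T"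
    proof (rule ennreal_le_epsilon)
      fix e :: real assume e: "0 < e"
      obtain n where n: "\<delta> n < min (c - t) e"
        using order_tendstoD(2)[OF \<delta>(2), of "min (c - t) e"] c(1) e
        by (auto simp: eventually_sequentially)
      define j where "j = nat \<lceil>t / \<delta> n\<rceil>"
      have j: "real j = of_int \<lceil>t / \<delta> n\<rceil>"
        unfolding j_def using t(2) \<delta>(1)[of n] by (simp add: divide_nonneg_pos)
      have "t / \<delta> n \<le> real j" "real j < t / \<delta> n + 1" unfolding j by linarith+
      then have j': "t \<le> real j * \<delta> n" "real j * \<delta> n < t + \<delta> n"
        using \<delta>(1)[of n] by (simp_all add: field_simps)
      have "X (real j * \<delta> n) \<omega> = z"
        using c(2)[of "real j * \<delta> n"] t(3) j' n by (cases "real j * \<delta> n = t") auto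
      then have "grid_time X z (\<delta> n) \<omega> \<le> ennreal (real j * \<delta> n)"
        unfolding grid_time_def by (intro Inf_lower) auto
      also have "\<dots> \<le> ennreal (t + e)" using j' n by (intro ennreal_leI) auto
      also have "\<dots> = T + ennreal e" using t e by (simp add: ennreal_plus)
      finally show "(INF n. grid_time X z (\<delta> n) \<omega>) \<le> T + ennreal e"
        by (meson INF_lower2 UNIV_I)
    qed
  qed
qed

section \<open>Mean first-passage times of Markov jump processes\<close>

lemma (in finite_measure) measure_partition:
  assumes "finite S" "\<And>\<omega>. \<omega> \<in> space M \<Longrightarrow> Q \<omega> \<Longrightarrow> Y \<omega> \<in> S"
    and "\<And>y. y \<in> S \<Longrightarrow> {\<omega>\<in>space M. Q \<omega> \<and> Y \<omega> = y} \<in> sets M"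
  shows "measure M {\<omega>\<in>space M. Q \<omega>} = (\<Sum>y\<in>S. measure M {\<omega>\<in>space M. Q \<omega> \<and> Y \<omega> = y})"
proof -
  have "{\<omega>\<in>space M. Q \<omega>} = (\<Union>y\<in>S. {\<omega>\<in>space M. Q \<omega> \<and> Y \<omega> = y})"
    using assms(2) by auto
  moreover have "measure M \<dots> = (\<Sum>y\<in>S. measure M {\<omega>\<in>space M. Q \<omega> \<and> Y \<omega> = y})"
    using assms by (intro finite_measure_finite_Union) (auto simp: disjoint_family_on_def)
  ultimately show ?thesis by simp
qed

text \<open>
  The finite-dimensional laws in the form of a Markov process with finitely many states: what
  the analysis of the process on a grid of times uses.
\<close>
locale markov_path_law = prob_space M
  for M :: "'w measure" +
  fixes K :: "'a set" and X :: "real \<Rightarrow> 'w \<Rightarrow> 'a" and P :: "real \<Rightarrow> 'a \<Rightarrow> 'a \<Rightarrow> real"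
  assumes finite_states: "finite K"
    and measurable_state: "0 \<le> s \<Longrightarrow> X s \<in> measurable M (count_space K)"
    and path_law: "0 \<le> t 0 \<Longrightarrow> \<forall>i\<le>n. t i \<le> t (Suc i) \<Longrightarrow> \<forall>i\<le>Suc n. x i \<in> K \<Longrightarrow>
      measure M {\<omega>\<in>space M. \<forall>i\<le>Suc n. X (t i) \<omega> = x i} =
      measure M {\<omega>\<in>space M. \<forall>i\<le>n. X (t i) \<omega> = x i} * P (t (Suc n) - t n) (x n) (x (Suc n))"
begin

lemma state_in: "0 \<le> t \<Longrightarrow> \<omega> \<in> space M \<Longrightarrow> X t \<omega> \<in> K"
  using measurable_space[OF measurable_state] by simp

lemma sets_state:
  assumes "0 \<le> t"
  shows "{\<omega>\<in>space M. X t \<omega> \<in> B} \<in> sets M"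
proof -
  have "{\<omega>\<in>space M. X t \<omega> \<in> B} = X t -` (B \<inter> K) \<inter> space M"
    using state_in[OF assms] by auto
  then show ?thesis using measurable_sets[OF measurable_state[OF assms], of "B \<inter> K"] by simp
qed

lemma sets_path:
  fixes n :: nat
  assumes "\<And>i. i \<le> n \<Longrightarrow> 0 \<le> t i"
  shows "{\<omega>\<in>space M. \<forall>i\<le>n. X (t i) \<omega> \<in> B i} \<in> sets M"
proof -
  have "{\<omega>\<in>space M. \<forall>i\<le>n. X (t i) \<omega> \<in> B i} = (\<Inter>i\<in>{..n}. {\<omega>\<in>space M. X (t i) \<omega> \<in> B i})"
    by auto
  also have "\<dots> \<in> sets M"
    using sets_state[OF assms] by (intro sets.finite_INT) simp_all
  finally show ?thesis .
qed

text \<open>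
  The Markov property conditional on an event of the past, obtained by summing over the finitely
  many paths that make up the event.
\<close>
lemma path_law_sets:
  assumes t: "0 \<le> t 0" "\<And>i. t i \<le> t (Suc i)" and B: "\<And>i. i \<le> n \<Longrightarrow> B i \<subseteq> K"
    and yv: "y \<in> K" "v \<in> K"
  shows "measure M {\<omega>\<in>space M. (\<forall>i\<le>n. X (t i) \<omega> \<in> B i) \<and> X (t n) \<omega> = y \<and> X (t (Suc n)) \<omega> = v} =
    measure M {\<omega>\<in>space M. (\<forall>i\<le>n. X (t i) \<omega> \<in> B i) \<and> X (t n) \<omega> = y} * P (t (Suc n) - t n) y v"
proof -
  have t0: "0 \<le> t i" for i
    using t by (induction i) (auto intro: order_trans)
  define S where "S = {xs \<in> PiE {..n} B. xs n = y}"
  have finS: "finite S"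
  proof (rule finite_subset)
    show "S \<subseteq> PiE {..n} B" by (auto simp: S_def)
    show "finite (PiE {..n} B)"
      using B finite_subset[OF _ finite_states] by (intro finite_PiE) simp_all
  qed
  define Y where "Y \<omega> = restrict (\<lambda>i. X (t i) \<omega>) {..n}" for \<omega>
  have Y_eq: "Y \<omega> = xs \<longleftrightarrow> (\<forall>i\<le>n. X (t i) \<omega> = xs i)" if "xs \<in> S" for \<omega> xs
  proof -
    have ext: "xs \<in> extensional {..n}" using that by (simp add: S_def PiE_def)
    have Y_ext: "Y \<omega> \<in> extensional {..n}" by (simp add: Y_def)
    have Y_app: "Y \<omega> i = X (t i) \<omega>" if "i \<le> n" for i using that by (simp add: Y_def)
    show ?thesis
    proof
      assume "Y \<omega> = xs"
      with Y_app show "\<forall>i\<le>n. X (t i) \<omega> = xs i" by metis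
    next
      assume "\<forall>i\<le>n. X (t i) \<omega> = xs i"
      with Y_app show "Y \<omega> = xs" by (intro extensionalityI[OF Y_ext ext]) simp
    qed
  qed
  have Y_in: "(\<forall>i\<le>n. X (t i) \<omega> \<in> B i) \<and> X (t n) \<omega> = y \<Longrightarrow> Y \<omega> \<in> S" for \<omega>
    by (auto simp: S_def Y_def)
  have path: "(\<forall>i\<le>n. X (t i) \<omega> \<in> B i) \<and> X (t n) \<omega> = y \<and> Y \<omega> = xs \<longleftrightarrow> (\<forall>i\<le>n. X (t i) \<omega> = xs i)"
    if "xs \<in> S" for xs \<omega>
    using that Y_eq[OF that, of \<omega>] by (auto simp: S_def PiE_iff)
  have ev1: "{\<omega>\<in>space M. ((\<forall>i\<le>n. X (t i) \<omega> \<in> B i) \<and> X (t n) \<omega> = y) \<and> Y \<omega> = xs} =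
      {\<omega>\<in>space M. \<forall>i\<le>n. X (t i) \<omega> = xs i}" if "xs \<in> S" for xs
    using path[OF that] by blast
  have ev2: "{\<omega>\<in>space M. ((\<forall>i\<le>n. X (t i) \<omega> \<in> B i) \<and> X (t n) \<omega> = y \<and> X (t (Suc n)) \<omega> = v) \<and> Y \<omega> = xs} =
      {\<omega>\<in>space M. \<forall>i\<le>Suc n. X (t i) \<omega> = (xs(Suc n := v)) i}" if "xs \<in> S" for xs
  proof -
    have "(\<forall>i\<le>Suc n. X (t i) \<omega> = (xs(Suc n := v)) i) \<longleftrightarrow>
        (\<forall>i\<le>n. X (t i) \<omega> = xs i) \<and> X (t (Suc n)) \<omega> = v" for \<omega>
      by (auto simp: le_Suc_eq)
    then show ?thesis using path[OF that] by blast
  qed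
  have "measure M {\<omega>\<in>space M. (\<forall>i\<le>n. X (t i) \<omega> \<in> B i) \<and> X (t n) \<omega> = y \<and> X (t (Suc n)) \<omega> = v} =
      (\<Sum>xs\<in>S. measure M {\<omega>\<in>space M. \<forall>i\<le>Suc n. X (t i) \<omega> = (xs(Suc n := v)) i})"
  proof (subst measure_partition[OF finS, of _ Y])
    fix xs assume "xs \<in> S"
    show "{\<omega>\<in>space M. ((\<forall>i\<le>n. X (t i) \<omega> \<in> B i) \<and> X (t n) \<omega> = y \<and> X (t (Suc n)) \<omega> = v) \<and> Y \<omega> = xs}
        \<in> sets M"
      unfolding ev2[OF \<open>xs \<in> S\<close>] using sets_path[of "Suc n" t "\<lambda>i. {(xs(Suc n := v)) i}"] t0
      by (simp only: singleton_iff)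
  next
    show "(\<Sum>xs\<in>S. measure M {\<omega>\<in>space M. ((\<forall>i\<le>n. X (t i) \<omega> \<in> B i) \<and> X (t n) \<omega> = y \<and>
        X (t (Suc n)) \<omega> = v) \<and> Y \<omega> = xs}) =
      (\<Sum>xs\<in>S. measure M {\<omega>\<in>space M. \<forall>i\<le>Suc n. X (t i) \<omega> = (xs(Suc n := v)) i})"
      by (intro sum.cong refl arg_cong[of _ _ "measure M"] ev2)
  qed (use Y_in in blast)
  also have "\<dots> = (\<Sum>xs\<in>S. measure M {\<omega>\<in>space M. \<forall>i\<le>n. X (t i) \<omega> = xs i} * P (t (Suc n) - t n) y v)"
  proof (intro sum.cong refl)
    fix xs assume xs: "xs \<in> S"
    have "xs i \<in> K" if "i \<le> n" for i
    proof -
      have "xs i \<in> B i" using xs that by (auto simp: S_def PiE_iff)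
      with B[OF that] show ?thesis by blast
    qed
    then have "\<forall>i\<le>Suc n. (xs(Suc n := v)) i \<in> K" using yv by (simp add: le_Suc_eq)
    moreover have "(\<forall>i\<le>n. X (t i) \<omega> = (xs(Suc n := v)) i) \<longleftrightarrow> (\<forall>i\<le>n. X (t i) \<omega> = xs i)" for \<omega>
      by auto
    ultimately show "measure M {\<omega>\<in>space M. \<forall>i\<le>Suc n. X (t i) \<omega> = (xs(Suc n := v)) i} =
        measure M {\<omega>\<in>space M. \<forall>i\<le>n. X (t i) \<omega> = xs i} * P (t (Suc n) - t n) y v"
      using path_law[of t n "xs(Suc n := v)"] t xs by (simp add: S_def)
  qed
  also have "\<dots> = (\<Sum>xs\<in>S. measure M {\<omega>\<in>space M. \<forall>i\<le>n. X (t i) \<omega> = xs i}) * P (t (Suc n) - t n) y v"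
    by (simp add: sum_distrib_right)
  also have "(\<Sum>xs\<in>S. measure M {\<omega>\<in>space M. \<forall>i\<le>n. X (t i) \<omega> = xs i}) =
      measure M {\<omega>\<in>space M. (\<forall>i\<le>n. X (t i) \<omega> \<in> B i) \<and> X (t n) \<omega> = y}"
  proof (subst measure_partition[OF finS, of "\<lambda>\<omega>. (\<forall>i\<le>n. X (t i) \<omega> \<in> B i) \<and> X (t n) \<omega> = y" Y])
    fix xs assume "xs \<in> S"
    show "{\<omega>\<in>space M. ((\<forall>i\<le>n. X (t i) \<omega> \<in> B i) \<and> X (t n) \<omega> = y) \<and> Y \<omega> = xs} \<in> sets M"
      unfolding ev1[OF \<open>xs \<in> S\<close>] using sets_path[of n t "\<lambda>i. {xs i}"] t0
      by (simp only: singleton_iff)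
  next
    show "(\<Sum>xs\<in>S. measure M {\<omega>\<in>space M. \<forall>i\<le>n. X (t i) \<omega> = xs i}) =
      (\<Sum>xs\<in>S. measure M {\<omega>\<in>space M. ((\<forall>i\<le>n. X (t i) \<omega> \<in> B i) \<and> X (t n) \<omega> = y) \<and> Y \<omega> = xs})"
      by (intro sum.cong refl arg_cong[of _ _ "measure M"] ev1[symmetric])
  qed (use Y_in in blast)
  finally show ?thesis .
qed

lemma sets_avoid:
  assumes "0 \<le> \<delta>"
  shows "{\<omega>\<in>space M. \<forall>i\<le>j. X (real i * \<delta>) \<omega> \<noteq> z} \<in> sets M"
proof -
  have "0 \<le> real i * \<delta>" for i using assms by simp
  from sets_path[of j "\<lambda>i. real i * \<delta>" "\<lambda>_. - {z}", OF this] show ?thesis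
    by (simp only: Compl_iff singleton_iff)
qed

lemma grid_time_eq_suminf_space:
  assumes "0 < \<delta>" "\<omega> \<in> space M"
  shows "grid_time X z \<delta> \<omega> =
    (\<Sum>j. ennreal \<delta> * indicator {\<omega>\<in>space M. \<forall>i\<le>j. X (real i * \<delta>) \<omega> \<noteq> z} \<omega>)"
  unfolding grid_time_eq_suminf[OF assms(1)]
  using assms(2) by (intro suminf_cong) (simp only: indicator_def mem_Collect_eq simp_thms)

lemma grid_time_measurable:
  assumes "0 < \<delta>"
  shows "grid_time X z \<delta> \<in> borel_measurable M"
proof -
  have "(\<lambda>\<omega>. \<Sum>j. ennreal \<delta> * indicator {\<omega>\<in>space M. \<forall>i\<le>j. X (real i * \<delta>) \<omega> \<noteq> z} \<omega>)
      \<in> borel_measurable M"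
    using sets_avoid[OF less_imp_le[OF assms]]
    by (intro borel_measurable_suminf_order borel_measurable_times_ennreal borel_measurable_const
        borel_measurable_indicator)
  then show ?thesis
    using grid_time_eq_suminf_space[OF assms] by (rule measurable_cong[THEN iffD2, rotated])
qed

text \<open>
  The chain killed at \<open>z\<close> starts with mass \<open>measure M {X 0 = x}\<close> at \<open>x\<close>; dividing the estimates of
  \<open>killed_chain_occupation\<close> by this mass gives the conditional expectation. If \<open>x = z\<close>, all sums
  vanish, in accordance with \<open>h z = 0\<close>.
\<close>
lemma grid_time_mean:
  assumes x: "x \<in> K" and z: "z \<in> K" and start: "0 < measure M {\<omega>\<in>space M. X 0 \<omega> = x}"
    and \<delta>: "0 < \<delta>" and \<epsilon>: "0 \<le> \<epsilon>" "\<epsilon> < 1"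
    and h: "\<And>y. y \<in> K \<Longrightarrow> 0 \<le> h y" "h z = 0"
    and drift: "\<And>y. y \<in> K \<Longrightarrow> y \<noteq> z \<Longrightarrow> \<bar>(\<Sum>v\<in>K. P \<delta> y v * h v) - h y + \<delta>\<bar> \<le> \<epsilon> * \<delta>"
  obtains E where
    "(\<integral>\<^sup>+ \<omega>. grid_time X z \<delta> \<omega> \<partial>uniform_measure M {\<omega>\<in>space M. X 0 \<omega> = x}) = ennreal E"
    "0 \<le> E" "(1 - \<epsilon>) * E \<le> h x" "h x \<le> (1 + \<epsilon>) * E"
proof -
  define A where "A = {\<omega>\<in>space M. X 0 \<omega> = x}"
  \<comment> \<open>The starting point and the killing at \<open>z\<close> are both expressed by the admissible sets.\<close>
  define B where "B i = (if i = 0 then {x} else K) - {z}" for i :: nat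
  define q where "q j y = measure M {\<omega>\<in>space M. (\<forall>i\<le>j. X (real i * \<delta>) \<omega> \<in> B i) \<and> X (real j * \<delta>) \<omega> = y}"
    for j y
  define p where "p = measure M A"
  have t0: "0 \<le> real i * \<delta>" for i using \<delta> by simp
  have A_sets: "A \<in> sets M" unfolding A_def using sets_state[of 0 "{x}"] by simp
  have BK: "B i \<subseteq> K" for i using x by (auto simp: B_def)
  have fin: "finite (K - {z})" using finite_states by simp
  have path_sets: "{\<omega>\<in>space M. (\<forall>i\<le>j. X (real i * \<delta>) \<omega> \<in> B i) \<and> X t \<omega> = y} \<in> sets M"
    if "0 \<le> t" for j t y
    using sets.Int[OF sets_path[of j "\<lambda>i. real i * \<delta>" B, OF t0] sets_state[OF that, of "{y}"]]
    by (simp add: Int_def conj_ac cong: conj_cong)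
  have B_avoid: "(\<forall>i\<le>j. X (real i * \<delta>) \<omega> \<in> B i) \<longleftrightarrow> \<omega> \<in> A \<and> (\<forall>i\<le>j. X (real i * \<delta>) \<omega> \<noteq> z)"
    if "\<omega> \<in> space M" for \<omega> j
  proof -
    have "X (real i * \<delta>) \<omega> \<in> B i \<longleftrightarrow> (i = 0 \<longrightarrow> \<omega> \<in> A) \<and> X (real i * \<delta>) \<omega> \<noteq> z" for i
      using state_in[OF t0 that] that by (auto simp: B_def A_def)
    then show ?thesis by auto
  qed
  have q_step: "q (Suc j) v = (\<Sum>y\<in>K - {z}. q j y * P \<delta> y v)" if v: "v \<in> K - {z}" for j v
  proof -
    have next_iff: "(\<forall>i\<le>Suc j. X (real i * \<delta>) \<omega> \<in> B i) \<and> X (real (Suc j) * \<delta>) \<omega> = v \<longleftrightarrow>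
        (\<forall>i\<le>j. X (real i * \<delta>) \<omega> \<in> B i) \<and> X (real (Suc j) * \<delta>) \<omega> = v" for \<omega>
      using v by (auto simp: B_def le_Suc_eq)
    have "q (Suc j) v =
        measure M {\<omega>\<in>space M. (\<forall>i\<le>j. X (real i * \<delta>) \<omega> \<in> B i) \<and> X (real (Suc j) * \<delta>) \<omega> = v}"
      unfolding q_def next_iff ..
    also have "\<dots> = (\<Sum>y\<in>K - {z}. measure M {\<omega>\<in>space M. ((\<forall>i\<le>j. X (real i * \<delta>) \<omega> \<in> B i) \<and>
        X (real (Suc j) * \<delta>) \<omega> = v) \<and> X (real j * \<delta>) \<omega> = y})"
    proof (rule measure_partition[OF fin])
      fix \<omega> assume "(\<forall>i\<le>j. X (real i * \<delta>) \<omega> \<in> B i) \<and> X (real (Suc j) * \<delta>) \<omega> = v"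
      then show "X (real j * \<delta>) \<omega> \<in> K - {z}" using BK[of j] by (auto simp: B_def)
    next
      fix y
      show "{\<omega>\<in>space M. ((\<forall>i\<le>j. X (real i * \<delta>) \<omega> \<in> B i) \<and>
          X (real (Suc j) * \<delta>) \<omega> = v) \<and> X (real j * \<delta>) \<omega> = y} \<in> sets M"
        using sets.Int[OF path_sets[OF t0, of j "Suc j" v] sets_state[OF t0, of j "{y}"]]
        by (simp add: Int_def conj_ac cong: conj_cong)
    qed
    also have "\<dots> = (\<Sum>y\<in>K - {z}. q j y * P \<delta> y v)"
    proof (intro sum.cong refl)
      fix y assume "y \<in> K - {z}"
      then show "measure M {\<omega>\<in>space M. ((\<forall>i\<le>j. X (real i * \<delta>) \<omega> \<in> B i) \<and>
          X (real (Suc j) * \<delta>) \<omega> = v) \<and> X (real j * \<delta>) \<omega> = y} = q j y * P \<delta> y v"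
        using path_law_sets[of "\<lambda>i. real i * \<delta>" j B y v] BK v \<delta>
        by (simp add: q_def conj_ac algebra_simps)
    qed
    finally show ?thesis .
  qed
  have drift': "\<bar>(\<Sum>v\<in>K - {z}. P \<delta> y v * h v) - h y + \<delta>\<bar> \<le> \<epsilon> * \<delta>" if "y \<in> K - {z}" for y
    using drift[of y] that h(2) sum.remove[OF finite_states z, of "\<lambda>v. P \<delta> y v * h v"] by simp
  have s_eq: "(\<Sum>y\<in>K - {z}. q j y) = measure M (A \<inter> {\<omega>\<in>space M. \<forall>i\<le>j. X (real i * \<delta>) \<omega> \<noteq> z})" for j
  proof -
    have "(\<Sum>y\<in>K - {z}. q j y) = measure M {\<omega>\<in>space M. \<forall>i\<le>j. X (real i * \<delta>) \<omega> \<in> B i}"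
      unfolding q_def
    proof (rule measure_partition[OF fin, symmetric])
      fix \<omega> assume "\<forall>i\<le>j. X (real i * \<delta>) \<omega> \<in> B i"
      then show "X (real j * \<delta>) \<omega> \<in> K - {z}" using BK[of j] by (auto simp: B_def)
    qed (rule path_sets[OF t0])
    also have "{\<omega>\<in>space M. \<forall>i\<le>j. X (real i * \<delta>) \<omega> \<in> B i} =
        A \<inter> {\<omega>\<in>space M. \<forall>i\<le>j. X (real i * \<delta>) \<omega> \<noteq> z}"
      using B_avoid[of _ j] by auto
    finally show ?thesis .
  qed
  have q0: "(\<Sum>y\<in>K - {z}. q 0 y * h y) = p * h x"
  proof -
    have "q 0 y * h y = (if y = x then p * h x else 0)" if "y \<in> K - {z}" for y
    proof -
      have "{\<omega>\<in>space M. (\<forall>i\<le>0. X (real i * \<delta>) \<omega> \<in> B i) \<and> X (real 0 * \<delta>) \<omega> = y} =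
          (if y = x then A else {})"
        using that by (auto simp: B_def A_def)
      then show ?thesis by (simp add: q_def p_def)
    qed
    then have "(\<Sum>y\<in>K - {z}. q 0 y * h y) = (\<Sum>y\<in>K - {z}. if y = x then p * h x else 0)"
      by (intro sum.cong) auto
    also have "\<dots> = p * h x" using fin x h(2) by (cases "x = z") (simp_all)
    finally show ?thesis .
  qed
  define s where "s j = (\<Sum>y\<in>K - {z}. q j y)" for j
  have q_nonneg: "0 \<le> q j y" for j y by (simp add: q_def)
  have occ: "summable s" "(1 - \<epsilon>) * (\<delta> * suminf s) \<le> p * h x" "p * h x \<le> (1 + \<epsilon>) * (\<delta> * suminf s)"
    using killed_chain_occupation[where q = q and P = "P \<delta>" and h = h, OF fin _ _ q_step drift' \<delta> \<epsilon>]
      q_nonneg h(1)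
    by (simp_all add: q0 s_def[abs_def])
  have s_nonneg: "0 \<le> s j" for j unfolding s_def using q_nonneg by (intro sum_nonneg)
  have p_pos: "0 < p" using start by (simp add: p_def A_def)
  define E where "E = \<delta> * suminf s / p"
  let ?U = "uniform_measure M A"
  note avoid_sets = sets_avoid[OF less_imp_le[OF \<delta>]]
  have "(\<integral>\<^sup>+ \<omega>. grid_time X z \<delta> \<omega> \<partial>?U) =
      (\<integral>\<^sup>+ \<omega>. (\<Sum>j. ennreal \<delta> * indicator {\<omega>\<in>space M. \<forall>i\<le>j. X (real i * \<delta>) \<omega> \<noteq> z} \<omega>) \<partial>?U)"
    by (intro nn_integral_cong grid_time_eq_suminf_space[OF \<delta>]) simp
  also have "\<dots> = (\<Sum>j. \<integral>\<^sup>+ \<omega>. ennreal \<delta> * indicator {\<omega>\<in>space M. \<forall>i\<le>j. X (real i * \<delta>) \<omega> \<noteq> z} \<omega> \<partial>?U)"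
    using avoid_sets
    by (intro nn_integral_suminf borel_measurable_times_ennreal borel_measurable_const borel_measurable_indicator)
      (simp only: sets_uniform_measure)
  also have "\<dots> = (\<Sum>j. ennreal (\<delta> * s j / p))"
  proof (intro suminf_cong)
    fix j
    let ?N = "{\<omega>\<in>space M. \<forall>i\<le>j. X (real i * \<delta>) \<omega> \<noteq> z}"
    have "(\<integral>\<^sup>+ \<omega>. ennreal \<delta> * indicator ?N \<omega> \<partial>?U) = ennreal \<delta> * emeasure ?U ?N"
      by (intro nn_integral_cmult_indicator) (simp only: sets_uniform_measure avoid_sets)
    also have "emeasure ?U ?N = ennreal (s j / p)"
      unfolding emeasure_uniform_measure[OF A_sets avoid_sets] emeasure_eq_measure s_def s_eq
      unfolding p_def[symmetric] using p_pos by (intro divide_ennreal measure_nonneg)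
    finally show "(\<integral>\<^sup>+ \<omega>. ennreal \<delta> * indicator ?N \<omega> \<partial>?U) = ennreal (\<delta> * s j / p)"
      using \<delta> s_nonneg p_pos by (simp add: ennreal_mult[symmetric])
  qed
  also have "\<dots> = ennreal E"
  proof -
    have "(\<lambda>j. \<delta> * s j / p) sums E"
      unfolding E_def using occ(1) by (intro sums_divide sums_mult summable_sums)
    then show ?thesis using s_nonneg \<delta> p_pos by (intro suminf_ennreal_eq) auto
  qed
  finally have "(\<integral>\<^sup>+ \<omega>. grid_time X z \<delta> \<omega> \<partial>?U) = ennreal E" .
  moreover have "0 \<le> E"
    unfolding E_def using \<delta> p_pos suminf_nonneg[OF occ(1) s_nonneg] by simp
  moreover have "(1 - \<epsilon>) * E \<le> h x" "h x \<le> (1 + \<epsilon>) * E"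
    unfolding E_def using occ(2,3) p_pos by (simp_all add: field_simps)
  ultimately show ?thesis using that unfolding A_def by blast
qed

end

lemma generator_sum:
  assumes "finite K" "y \<in> K"
  shows "(\<Sum>v\<in>K. generator K k y v * h v) = (\<Sum>v\<in>K. k y v * (h v - h y))"
proof -
  have "(\<Sum>v\<in>K. generator K k y v * h v) =
      - (\<Sum>u\<in>K - {y}. k y u) * h y + (\<Sum>v\<in>K - {y}. generator K k y v * h v)"
    unfolding sum.remove[OF assms] by (simp add: generator_def)
  also have "(\<Sum>v\<in>K - {y}. generator K k y v * h v) = (\<Sum>v\<in>K - {y}. k y v * h v)"
    by (intro sum.cong) (auto simp: generator_def)
  also have "- (\<Sum>u\<in>K - {y}. k y u) * h y + (\<Sum>v\<in>K - {y}. k y v * h v) = (\<Sum>v\<in>K - {y}. k y v * (h v - h y))"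
    by (simp add: sum_distrib_right right_diff_distrib sum_subtractf)
  also have "\<dots> = (\<Sum>v\<in>K. k y v * (h v - h y))"
    unfolding sum.remove[OF assms] by simp
  finally show ?thesis .
qed

text \<open>
  The generator is the derivative of \<open>P\<close> at time \<open>0\<close>, so this is the difference quotient of
  \<open>P t h\<close> there.
\<close>
lemma semigroup_drift:
  assumes K: "finite K" and P: "transition_function K k P" and y: "y \<in> K"
    and \<delta>: "\<And>n. 0 < \<delta> n" "\<delta> \<longlonglongrightarrow> 0"
  shows "(\<lambda>n. ((\<Sum>v\<in>K. P (\<delta> n) y v * h v) - h y) / \<delta> n) \<longlonglongrightarrow> (\<Sum>v\<in>K. k y v * (h v - h y))"
proof -
  have P0: "(\<Sum>v\<in>K. P 0 y v * h v) = h y"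
  proof -
    have "(\<Sum>v\<in>K. P 0 y v * h v) = (\<Sum>v\<in>K. if y = v then h v else 0)"
      using P y by (intro sum.cong) (auto simp: transition_function_def)
    then show ?thesis using K y by simp
  qed
  have "((\<lambda>t. \<Sum>v\<in>K. P t y v * h v) has_real_derivative (\<Sum>v\<in>K. generator K k y v * h v)) (at 0 within {0..})"
    using P y by (intro DERIV_sum DERIV_cmult_right) (auto simp: transition_function_def)
  then have "((\<lambda>t. ((\<Sum>v\<in>K. P t y v * h v) - h y) / t) \<longlongrightarrow> (\<Sum>v\<in>K. k y v * (h v - h y))) (at 0 within {0..})"
    unfolding has_field_derivative_iff generator_sum[OF K y] by (simp add: P0)
  moreover have "filterlim \<delta> (at 0 within {0..}) sequentially"
    unfolding filterlim_at using \<delta>(2)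
  proof (intro conjI always_eventually allI)
    fix n
    from \<delta>(1)[of n] show "\<delta> n \<in> {0..}" "\<delta> n \<noteq> 0" by simp_all
  qed
  ultimately show ?thesis by (rule filterlim_compose)
qed

text \<open>
  Dyadic mesh widths make the grids nested, so that the grid times decrease with \<open>n\<close>.
\<close>
theorem mean_first_passage_time_eq_solution:
  assumes K: "finite K" and X: "markov_jump_process K k M X" and x: "x \<in> K" and z: "z \<in> K"
    and start: "0 < measure M {\<omega>\<in>space M. X 0 \<omega> = x}"
    and h: "\<And>y. y \<in> K \<Longrightarrow> 0 \<le> h y" "h z = 0"
      "\<And>y. y \<in> K \<Longrightarrow> y \<noteq> z \<Longrightarrow> (\<Sum>v\<in>K. k y v * (h v - h y)) + 1 = 0"
  shows "mean_first_passage_time M X x z = ennreal (h x)"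
proof -
  note X' = X[unfolded markov_jump_process_def]
  from X' obtain P where P: "transition_function K k P" and
    law: "\<And>n t x. 0 \<le> t 0 \<Longrightarrow> \<forall>i\<le>n. t i \<le> t (Suc i) \<Longrightarrow> \<forall>i\<le>Suc n. x i \<in> K \<Longrightarrow>
      measure M {\<omega>\<in>space M. \<forall>i\<le>Suc n. X (t i) \<omega> = x i} =
      measure M {\<omega>\<in>space M. \<forall>i\<le>n. X (t i) \<omega> = x i} * P (t (Suc n) - t n) (x n) (x (Suc n))"
    by auto
  have right: "eventually (\<lambda>s. X s \<omega> = X t \<omega>) (at_right t)" if "\<omega> \<in> space M" "0 \<le> t" for \<omega> t
    using X' that by (elim conjE) blast
  have prob: "prob_space M" using X' by (elim conjE)
  have state: "X s \<in> measurable M (count_space K)" if "0 \<le> s" for s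
    using X' that by (elim conjE) blast
  have pl: "markov_path_law M K X P"
    unfolding markov_path_law_def markov_path_law_axioms_def
    using prob K state law by (intro conjI allI impI) simp_all
  interpret markov_path_law M K X P by (rule pl)
  define \<delta> where "\<delta> n = (1 / 2 ^ n :: real)" for n :: nat
  have \<delta>_pos: "0 < \<delta> n" for n by (simp add: \<delta>_def)
  have \<delta>_lim: "\<delta> \<longlonglongrightarrow> 0"
    unfolding \<delta>_def[abs_def] using LIMSEQ_divide_realpow_zero[of 2 1] by simp
  let ?U = "uniform_measure M {\<omega>\<in>space M. X 0 \<omega> = x}"
  define e where "e n = (\<integral>\<^sup>+ \<omega>. grid_time X z (\<delta> n) \<omega> \<partial>?U)" for n
  \<comment> \<open>The total relative error of the drift at mesh width \<open>\<delta> n\<close>.\<close>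
  define \<epsilon> where "\<epsilon> n = (\<Sum>y\<in>K - {z}. \<bar>((\<Sum>v\<in>K. P (\<delta> n) y v * h v) - h y) / \<delta> n + 1\<bar>)" for n
  have \<epsilon>_nonneg: "0 \<le> \<epsilon> n" for n unfolding \<epsilon>_def by (intro sum_nonneg) simp
  have "\<epsilon> \<longlonglongrightarrow> (\<Sum>y\<in>K - {z}. \<bar>(\<Sum>v\<in>K. k y v * (h v - h y)) + 1\<bar>)"
    unfolding \<epsilon>_def[abs_def] using semigroup_drift[OF K P _ \<delta>_pos \<delta>_lim]
    by (intro tendsto_sum tendsto_rabs tendsto_add tendsto_const) auto
  then have \<epsilon>_lim: "\<epsilon> \<longlonglongrightarrow> 0" using h(3) by simp
  then have \<epsilon>_small: "eventually (\<lambda>n. \<epsilon> n < 1) sequentially"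
    by (rule order_tendstoD) simp
  have drift: "\<bar>(\<Sum>v\<in>K. P (\<delta> n) y v * h v) - h y + \<delta> n\<bar> \<le> \<epsilon> n * \<delta> n" if "y \<in> K" "y \<noteq> z" for n y
  proof -
    have "\<bar>((\<Sum>v\<in>K. P (\<delta> n) y v * h v) - h y) / \<delta> n + 1\<bar> \<le> \<epsilon> n"
      unfolding \<epsilon>_def using that K by (intro member_le_sum) auto
    moreover have "(\<Sum>v\<in>K. P (\<delta> n) y v * h v) - h y + \<delta> n =
        (((\<Sum>v\<in>K. P (\<delta> n) y v * h v) - h y) / \<delta> n + 1) * \<delta> n"
      using \<delta>_pos[of n] by (simp add: field_simps)
    ultimately show ?thesis
      using \<delta>_pos[of n] by (simp add: abs_mult mult_right_mono)
  qed
  have e_bounds: "e n = ennreal (enn2real (e n)) \<and>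
      h x / (1 + \<epsilon> n) \<le> enn2real (e n) \<and> enn2real (e n) \<le> h x / (1 - \<epsilon> n)" if small: "\<epsilon> n < 1" for n
  proof -
    obtain E where E: "e n = ennreal E" "0 \<le> E" "(1 - \<epsilon> n) * E \<le> h x" "h x \<le> (1 + \<epsilon> n) * E"
      unfolding e_def
      by (rule grid_time_mean[OF x z start \<delta>_pos[of n] \<epsilon>_nonneg[of n] small h(1,2) drift[of _ n]])
    then show ?thesis using small \<epsilon>_nonneg[of n]
      by (simp add: pos_divide_le_eq pos_le_divide_eq mult.commute)
  qed
  have "(\<lambda>n. enn2real (e n)) \<longlonglongrightarrow> h x"
  proof (rule tendsto_sandwich)
    show "eventually (\<lambda>n. h x / (1 + \<epsilon> n) \<le> enn2real (e n)) sequentially"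
      "eventually (\<lambda>n. enn2real (e n) \<le> h x / (1 - \<epsilon> n)) sequentially"
      using \<epsilon>_small by (eventually_elim, use e_bounds in blast)+
    show "(\<lambda>n. h x / (1 + \<epsilon> n)) \<longlonglongrightarrow> h x" "(\<lambda>n. h x / (1 - \<epsilon> n)) \<longlonglongrightarrow> h x"
      using tendsto_divide[OF tendsto_const[of "h x"] tendsto_add[OF tendsto_const[of 1] \<epsilon>_lim]]
        tendsto_divide[OF tendsto_const[of "h x"] tendsto_diff[OF tendsto_const[of 1] \<epsilon>_lim]] by simp_all
  qed
  then have "(\<lambda>n. ennreal (enn2real (e n))) \<longlonglongrightarrow> ennreal (h x)"
    by (rule tendsto_ennrealI)
  moreover have "eventually (\<lambda>n. ennreal (enn2real (e n)) = e n) sequentially"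
    using \<epsilon>_small by eventually_elim (use e_bounds in metis)
  ultimately have e_lim: "e \<longlonglongrightarrow> ennreal (h x)"
    by (rule Lim_transform_eventually)
  have dec: "grid_time X z (\<delta> (Suc n)) \<omega> \<le> grid_time X z (\<delta> n) \<omega>" for n \<omega>
    using grid_time_refine[of 2 X z "\<delta> n" \<omega>] by (simp add: \<delta>_def mult.commute)
  then have "decseq e"
    unfolding e_def by (intro decseq_SucI nn_integral_mono)
  obtain N where N: "\<epsilon> N < 1" using \<epsilon>_small by (auto simp: eventually_sequentially)
  obtain r where "e N = ennreal r" using e_bounds[OF N] by blast
  then have finite_mean: "e N < \<infinity>" by simp
  have "mean_first_passage_time M X x z = (\<integral>\<^sup>+ \<omega>. (INF n. grid_time X z (\<delta> n) \<omega>) \<partial>?U)"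
    unfolding mean_first_passage_time_def
    by (intro nn_integral_cong first_passage_time_eq_INF_grid_time right \<delta>_pos \<delta>_lim) auto
  also have "\<dots> = (INF n. e n)"
    unfolding e_def
  proof (rule nn_integral_monotone_convergence_INF_AE[where i = N])
    show "(\<integral>\<^sup>+ \<omega>. grid_time X z (\<delta> N) \<omega> \<partial>?U) < \<infinity>"
      using finite_mean unfolding e_def .
  qed (use dec grid_time_measurable[OF \<delta>_pos] in auto)
  also have "\<dots> = ennreal (h x)"
    using LIMSEQ_INF[OF \<open>decseq e\<close>] e_lim by (rule LIMSEQ_unique)
  finally show ?thesis .
qed

section \<open>The forest formula for mean first-passage times\<close>

theorem mainTheorem2:
  fixes K :: "'a set" and k :: "'a \<Rightarrow> 'a \<Rightarrow> real"
    and \<tau> :: "'a \<Rightarrow> 'a \<Rightarrow> real"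
    and M :: "'w measure" and X :: "real \<Rightarrow> 'w \<Rightarrow> 'a"
  assumes "finite K"
    and "\<forall>x\<in>K. \<forall>y\<in>K. x \<noteq> y \<longrightarrow> 0 \<le> k x y"
    and "irreducible_rates K k"
  shows "(first_passage_equations K k \<tau> \<longleftrightarrow>
            (\<forall>x\<in>K. \<forall>z\<in>K. \<tau> x z = (if x = z then 0 else forest_weight K k x z / tree_weight K k z))) \<and>
         (markov_jump_process K k M X \<longrightarrow>
            (\<forall>x\<in>K. \<forall>z\<in>K. measure M {\<omega>\<in>space M. X 0 \<omega> = x} > 0 \<longrightarrow>
               mean_first_passage_time M X x z =
               ennreal (if x = z then 0 else forest_weight K k x z / tree_weight K k z)))"
proof (intro conjI impI ballI)
  show "first_passage_equations K k \<tau> \<longleftrightarrow>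
      (\<forall>x\<in>K. \<forall>z\<in>K. \<tau> x z = (if x = z then 0 else forest_weight K k x z / tree_weight K k z))"
    using assms by (rule first_passage_equations_iff)
next
  fix x z
  assume X: "markov_jump_process K k M X" and xz: "x \<in> K" "z \<in> K"
    and start: "0 < measure M {\<omega>\<in>space M. X 0 \<omega> = x}"
  define \<sigma> where "\<sigma> x z = (if x = z then 0 else forest_weight K k x z / tree_weight K k z)" for x z
  have solves: "first_passage_equations K k \<sigma>"
    using first_passage_equations_iff[OF assms, of \<sigma>] by (simp add: \<sigma>_def)
  have nonneg: "0 \<le> \<sigma> y z" if "y \<in> K" for y
  proof -
    have "0 \<le> forest_weight K k y z"
      unfolding forest_weight_eq[OF assms(1) xz(2) that assms(2)]
      by (intro sum_nonneg map_weight_nonneg[OF assms(2)]) (simp add: forest_maps_def)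
    then show ?thesis
      using tree_weight_pos[OF assms xz(2)] by (simp add: \<sigma>_def)
  qed
  have "mean_first_passage_time M X x z = ennreal (\<sigma> x z)"
    using solves xz(2)
    by (intro mean_first_passage_time_eq_solution[OF assms(1) X xz start, of "\<lambda>y. \<sigma> y z"] nonneg)
      (simp_all add: first_passage_equations_def)
  then show "mean_first_passage_time M X x z =
      ennreal (if x = z then 0 else forest_weight K k x z / tree_weight K k z)"
    by (simp only: \<sigma>_def)
qed

end
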